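(* Let $R$ be a Noetherian local ring with maximal ideal $\mathfrak m$ and $\dim R=1$. Assume that $\mathfrak m^2 H^0_{\mathfrak m}(R)=(0)$. If $\mathrm{v}(R)\le 4$, then $$\mathrm{Ext}_R^1(R/Q,R)\neq (0)$$ for every parameter ideal $Q$ in $R$.
   Context: Rings are commutative. $H^0_{\mathfrak m}(R)=\{x\in R : \mathfrak m^s x=(0)\text{ for some } s>0\}$ is the $0$-th local cohomology module of $R$. $\mathrm{v}(R)=\ell_R(\mathfrak m/\mathfrak m^2)$ is the embedding dimension of $R$, where $\ell_R$ denotes length. A parameter ideal of a one-dimensional Noetherian local ring $(R,\mathfrak m)$ is an $\mathfrak m$-primary principal ideal $(a)$ with $a\in\mathfrak m$. *)

theory Defs
  imports "HOL-Algebra.Algebra" "HOL-Library.Extended_Nat"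
begin

section \<open>Ideals, local rings, dimension\<close>

locale local_ring = maximalideal \<mm> R + cring R for \<mm> and R (structure) +
  assumes unique_maximal: "maximalideal J R \<Longrightarrow> J = \<mm>"

primrec ideal_power :: "('a, 'b) ring_scheme \<Rightarrow> 'a set \<Rightarrow> nat \<Rightarrow> 'a set" where
  "ideal_power R I 0 = carrier R"
| "ideal_power R I (Suc n) = ideal_prod R I (ideal_power R I n)"

definition krull_dim :: "('a, 'b) ring_scheme \<Rightarrow> enat" where
  "krull_dim R = Sup {enat n | n. \<exists>P :: nat \<Rightarrow> 'a set.
     (\<forall>i\<le>n. primeideal (P i) R) \<and> (\<forall>i<n. P i \<subset> P (Suc i))}"

definition radical :: "('a, 'b) ring_scheme \<Rightarrow> 'a set \<Rightarrow> 'a set" where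
  "radical R I = {x \<in> carrier R. \<exists>n::nat. x [^]\<^bsub>R\<^esub> n \<in> I}"

locale primaryideal = ideal + cring +
  assumes I_notcarr: "carrier R \<noteq> I"
    and I_primary: "\<lbrakk>a \<in> carrier R; b \<in> carrier R; a \<otimes> b \<in> I; a \<notin> I\<rbrakk> \<Longrightarrow> b \<in> radical R I"

definition parameter_ideal :: "('a, 'b) ring_scheme \<Rightarrow> 'a set \<Rightarrow> 'a set \<Rightarrow> bool" where
  "parameter_ideal R \<mm> Q \<longleftrightarrow>
     (\<exists>a\<in>\<mm>. Q = PIdl\<^bsub>R\<^esub> a) \<and> primaryideal Q R \<and> radical R Q = \<mm>"

definition local_cohomology_0 :: "('a, 'b) ring_scheme \<Rightarrow> 'a set \<Rightarrow> 'a set" where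
  "local_cohomology_0 R \<mm> =
     {x \<in> carrier R. \<exists>s>0. \<forall>y\<in>ideal_power R \<mm> s. y \<otimes>\<^bsub>R\<^esub> x = \<zero>\<^bsub>R\<^esub>}"


section \<open>Modules\<close>

text \<open>The record type of modules extends that of rings, but the locale \<^locale>\<open>module\<close>
  never refers to the multiplication and the unit of the module; they are left unspecified.\<close>

definition make_module ::
    "'m set \<Rightarrow> 'm \<Rightarrow> ('m \<Rightarrow> 'm \<Rightarrow> 'm) \<Rightarrow> ('a \<Rightarrow> 'm \<Rightarrow> 'm) \<Rightarrow> ('a, 'm) module" where
  "make_module C z p s =
     \<lparr>carrier = C, monoid.mult = undefined, one = undefined, ring.zero = z, ring.add = p, smult = s\<rparr>"

definition regular_module :: "('a, 'b) ring_scheme \<Rightarrow> ('a, 'a) module" where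
  "regular_module R = make_module (carrier R) \<zero>\<^bsub>R\<^esub> (ring.add R) (monoid.mult R)"

definition quotient_module :: "('a, 'm, 'c) module_scheme \<Rightarrow> 'm set \<Rightarrow> ('a, 'm set) module" where
  "quotient_module M N = make_module (a_rcosets\<^bsub>M\<^esub> N) N (set_add M)
     (\<lambda>r S. \<Union>x\<in>S. N +>\<^bsub>M\<^esub> (r \<odot>\<^bsub>M\<^esub> x))"

definition module_length :: "('a, 'b) ring_scheme \<Rightarrow> ('a, 'm, 'c) module_scheme \<Rightarrow> enat" where
  "module_length R M = Sup {enat n | n. \<exists>N :: nat \<Rightarrow> 'm set.
     (\<forall>i\<le>n. submodule (N i) R M) \<and> (\<forall>i<n. N i \<subset> N (Suc i))}"

definition embedding_dim :: "('a, 'b) ring_scheme \<Rightarrow> 'a set \<Rightarrow> enat" where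
  "embedding_dim R \<mm> = module_length R
     (quotient_module (regular_module R\<lparr>carrier := \<mm>\<rparr>) (ideal_power R \<mm> 2))"

definition module_hom ::
    "('a, 'b) ring_scheme \<Rightarrow> ('a, 'm, 'c) module_scheme \<Rightarrow> ('a, 'n, 'd) module_scheme \<Rightarrow> ('m \<Rightarrow> 'n) set" where
  "module_hom R M N = {f \<in> carrier M \<rightarrow>\<^sub>E carrier N.
     (\<forall>x\<in>carrier M. \<forall>y\<in>carrier M. f (x \<oplus>\<^bsub>M\<^esub> y) = f x \<oplus>\<^bsub>N\<^esub> f y) \<and>
     (\<forall>r\<in>carrier R. \<forall>x\<in>carrier M. f (r \<odot>\<^bsub>M\<^esub> x) = r \<odot>\<^bsub>N\<^esub> f x)}"

definition Hom_module ::
    "('a, 'b) ring_scheme \<Rightarrow> ('a, 'm, 'c) module_scheme \<Rightarrow> ('a, 'n, 'd) module_scheme \<Rightarrow> ('a, 'm \<Rightarrow> 'n) module" where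
  "Hom_module R M N = make_module (module_hom R M N)
     (\<lambda>x\<in>carrier M. \<zero>\<^bsub>N\<^esub>)
     (\<lambda>f g. \<lambda>x\<in>carrier M. f x \<oplus>\<^bsub>N\<^esub> g x)
     (\<lambda>r f. \<lambda>x\<in>carrier M. r \<odot>\<^bsub>N\<^esub> f x)"

text \<open>The homology at \<open>B\<close> of a complex \<open>A \<rightarrow> B \<rightarrow> C\<close> with maps \<open>d\<close> and \<open>e\<close>.\<close>

definition homology_module ::
    "('a, 'm, 'c) module_scheme \<Rightarrow> ('a, 'n) module \<Rightarrow> ('a, 'p, 'd) module_scheme \<Rightarrow>
     ('m \<Rightarrow> 'n) \<Rightarrow> ('n \<Rightarrow> 'p) \<Rightarrow> ('a, 'n set) module" where
  "homology_module A B C d e = quotient_module (B\<lparr>carrier := a_kernel B C e\<rparr>) (d ` carrier A)"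


section \<open>The standard free resolution and \<open>Ext\<^sup>1\<close>\<close>

definition free_module :: "('a, 'b) ring_scheme \<Rightarrow> 'x set \<Rightarrow> ('a, 'x \<Rightarrow> 'a) module" where
  "free_module R S = make_module
     {f. range f \<subseteq> carrier R \<and> finite {x. f x \<noteq> \<zero>\<^bsub>R\<^esub>} \<and> {x. f x \<noteq> \<zero>\<^bsub>R\<^esub>} \<subseteq> S}
     (\<lambda>x. \<zero>\<^bsub>R\<^esub>) (\<lambda>f g x. f x \<oplus>\<^bsub>R\<^esub> g x) (\<lambda>r f x. r \<otimes>\<^bsub>R\<^esub> f x)"

definition free_cover :: "('a, 'b) ring_scheme \<Rightarrow> ('a, 'm, 'c) module_scheme \<Rightarrow> ('a, 'm \<Rightarrow> 'a) module" where
  "free_cover R M = free_module R (carrier M)"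

text \<open>The canonical surjection from \<open>free_cover R M\<close> onto \<open>M\<close>, sending the basis element
  indexed by \<open>x\<close> to \<open>x\<close>.\<close>

definition cover_map ::
    "('a, 'b) ring_scheme \<Rightarrow> ('a, 'm, 'c) module_scheme \<Rightarrow> ('m \<Rightarrow> 'a) \<Rightarrow> 'm" where
  "cover_map R M f = (\<Oplus>\<^bsub>M\<^esub>x \<in> {x. f x \<noteq> \<zero>\<^bsub>R\<^esub>}. f x \<odot>\<^bsub>M\<^esub> x)"

definition syzygy :: "('a, 'b) ring_scheme \<Rightarrow> ('a, 'm, 'c) module_scheme \<Rightarrow> ('a, 'm \<Rightarrow> 'a) module" where
  "syzygy R M = (free_cover R M)\<lparr>carrier := a_kernel (free_cover R M) M (cover_map R M)\<rparr>"

text \<open>Splicing the sequences \<open>0 \<rightarrow> syzygy L \<rightarrow> free_cover L \<rightarrow> L \<rightarrow> 0\<close> for \<open>L = M\<close>,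
  \<open>L = syzygy M\<close>, \<dots> gives a free resolution \<open>\<dots> \<rightarrow> F2 \<rightarrow> F1 \<rightarrow> F0 \<rightarrow> M \<rightarrow> 0\<close>, whose differentials
  \<open>F1 \<rightarrow> F0\<close> and \<open>F2 \<rightarrow> F1\<close> are \<open>cover_map R (syzygy R M)\<close> and
  \<open>cover_map R (syzygy R (syzygy R M))\<close>. \<open>Ext\<^sup>1(M, N)\<close> is the cohomology of
  \<open>Hom(F0, N) \<rightarrow> Hom(F1, N) \<rightarrow> Hom(F2, N)\<close>.\<close>

definition Ext1 ::
    "('a, 'b) ring_scheme \<Rightarrow> ('a, 'm, 'c) module_scheme \<Rightarrow> ('a, 'n, 'd) module_scheme \<Rightarrow>
     ('a, ((('m \<Rightarrow> 'a) \<Rightarrow> 'a) \<Rightarrow> 'n) set) module" where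
  "Ext1 R M N =
    (let F0 = free_cover R M;
         F1 = free_cover R (syzygy R M);
         F2 = free_cover R (syzygy R (syzygy R M));
         d1 = cover_map R (syzygy R M);
         d2 = cover_map R (syzygy R (syzygy R M))
     in homology_module (Hom_module R F0 N) (Hom_module R F1 N) (Hom_module R F2 N)
          (\<lambda>\<psi>. compose (carrier F1) \<psi> d1) (\<lambda>\<phi>. compose (carrier F2) \<phi> d2))"

end

theory Submission
  imports Defs
begin

text \<open>
  Let \<open>Q = (a)\<close>. From the start \<open>\<dots> \<rightarrow> R \<rightarrow> R\<close> (multiplication by \<open>a\<close>) of a resolution of \<open>R/Q\<close> one reads off
  \<open>Ext\<^sup>1(R/Q, R) = (0 : (0 : a))/(a)\<close>. If this vanishes, \<open>I = 0 : a\<close> is a faithful \<open>R/(a)\<close>-module.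
  As \<open>I \<subseteq> H\<close>, the zeroth local cohomology, \<open>\<mm>\<^sup>2\<close> kills \<open>I\<close>, so \<open>\<mm>\<^sup>2 \<subseteq> (a) \<subseteq> \<mm>\<close>.

  Let \<open>r\<close>, \<open>p\<close>, \<open>q\<close> be the lengths of \<open>\<mm>/(a)\<close>, \<open>I/\<mm>I\<close>, \<open>\<mm>I\<close>; thus \<open>r \<le> v(R) \<le> 4\<close>. Faithfulness embeds \<open>\<mm>/(a)\<close> into
  \<open>Hom(I/\<mm>I, \<mm>I)\<close>, so \<open>r \<le> pq\<close>. Multiplication by \<open>a\<close> is injective on \<open>R/H\<close>, so the snake lemma
  gives \<open>\<ell>(R/(a)) = \<ell>(R/(aR + H)) + \<ell>(I)\<close>, that is, \<open>1 + r = \<ell>(R/(aR + H)) + p + q\<close>. Here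
  \<open>aR + H \<noteq> R\<close>. If \<open>r \<le> 3\<close>, then \<open>p + q \<le> r \<le> pq\<close> forces \<open>p = q = 0\<close>, so \<open>I = 0\<close> and
  \<open>(a) = 0 : I = R\<close>, which is absurd. If \<open>r = 4\<close>, then \<open>(a) = \<mm>\<^sup>2\<close>; in this case \<open>aR + H \<noteq> \<mm>\<close>, because otherwise
  \<open>a\<mm>\<^sup>2 \<subseteq> (a\<^sup>3)\<close> and \<open>a\<^sup>2 = 0\<close>. Hence \<open>p + q \<le> 3\<close>, which contradicts \<open>4 \<le> pq\<close>.
\<close>

no_notation Sum_Type.Plus (infixr \<open><+>\<close> 65)

section \<open>Lengths of subquotients of the ring\<close>

text \<open>The recursion peels off the lowest step, so \<open>A\<close> stays fixed while the lower
  end varies. The topmost ideal only has to lie inside \<open>A\<close>, and \<open>A\<close> and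
  \<open>B\<close> may be arbitrary sets, which makes monotonicity in both a plain
  induction.\<close>

primrec ideal_chain :: "('a, 'b) ring_scheme \<Rightarrow> nat \<Rightarrow> 'a set \<Rightarrow> 'a set \<Rightarrow> bool" where
  "ideal_chain R 0 A B \<longleftrightarrow> B \<subseteq> A"
| "ideal_chain R (Suc n) A B \<longleftrightarrow> (\<exists>C. ideal C R \<and> B \<subset> C \<and> ideal_chain R n A C)"

text \<open>The length of the module \<open>A/B\<close>, for ideals \<open>B \<subseteq> A\<close>.\<close>

definition ideal_length :: "('a, 'b) ring_scheme \<Rightarrow> 'a set \<Rightarrow> 'a set \<Rightarrow> enat" where
  "ideal_length R A B = Sup {enat n | n. ideal_chain R n A B}"

definition annihilator :: "('a, 'b) ring_scheme \<Rightarrow> 'a set \<Rightarrow> 'a set" where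
  "annihilator R Z = {r \<in> carrier R. \<forall>x\<in>Z. r \<otimes>\<^bsub>R\<^esub> x = \<zero>\<^bsub>R\<^esub>}"

lemma ideal_chain_subset: "ideal_chain R n A B \<Longrightarrow> B \<subseteq> A"
proof (induction n arbitrary: B)
  case (Suc n)
  then show ?case by fastforce
qed simp

lemma ideal_chain_mono:
  assumes "ideal_chain R n A B" "A \<subseteq> A'" "B' \<subseteq> B"
  shows "ideal_chain R n A' B'"
  using assms
proof (induction n arbitrary: B B')
  case 0
  then show ?case by auto
next
  case (Suc n)
  then obtain C where C: "ideal C R" "B \<subset> C" "ideal_chain R n A C" by auto
  with Suc.prems have "B' \<subset> C" "ideal_chain R n A' C" using Suc.IH[of C C] by auto
  with C(1) show ?case by auto
qed

lemma ideal_chain_SucD: "ideal_chain R (Suc n) A B \<Longrightarrow> ideal_chain R n A B"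
  using ideal_chain_mono[of R n A] by auto

lemma ideal_chain_le: "ideal_chain R n A B \<Longrightarrow> m \<le> n \<Longrightarrow> ideal_chain R m A B"
  by (induction n) (auto simp: le_Suc_eq dest: ideal_chain_SucD simp del: ideal_chain.simps(2))

lemma ideal_chain_concat:
  assumes "ideal_chain R m B C" "ideal_chain R n A B"
  shows "ideal_chain R (m + n) A C"
  using assms
proof (induction m arbitrary: C)
  case 0
  then show ?case using ideal_chain_mono by fastforce
next
  case (Suc m)
  then show ?case by auto
qed

lemma le_ideal_length: "ideal_chain R n A B \<Longrightarrow> enat n \<le> ideal_length R A B"
  unfolding ideal_length_def by (auto intro: Sup_upper)

text \<open>Chains can be shortened, so the realised lengths form an initial segment of the
  naturals, nonempty by \<open>B \<subseteq> A\<close>. Every finite number below the supremum is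
  therefore realised, which turns inequalities between lengths into statements about chains.\<close>

lemma ideal_chain_iff:
  assumes "B \<subseteq> A"
  shows "ideal_chain R n A B \<longleftrightarrow> enat n \<le> ideal_length R A B"
proof
  assume le: "enat n \<le> ideal_length R A B"
  show "ideal_chain R n A B"
  proof (rule ccontr)
    assume no: "\<not> ideal_chain R n A B"
    with assms obtain k where k: "n = Suc k" by (cases n) auto
    have "m \<le> k" if "ideal_chain R m A B" for m
      using that no ideal_chain_le[of R m A B n] k by (meson not_less_eq_eq)
    then have "ideal_length R A B \<le> enat k"
      unfolding ideal_length_def by (auto intro: Sup_least)
    with le k show False by (meson enat_ord_simps(1) not_less_eq_eq order_refl order_trans)
  qed
qed (rule le_ideal_length)

text \<open>An extended natural is determined by the finite numbers below it. With this test,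
  infinite lengths need no separate case when lengths are compared.\<close>

lemma enat_leI:
  fixes x y :: enat
  assumes "\<And>n. enat n \<le> x \<Longrightarrow> enat n \<le> y"
  shows "x \<le> y"
proof (cases x)
  case infinity
  then have "enat n \<le> y" for n using assms by simp
  then have "y = \<infinity>" by (metis Suc_n_not_le_n enat.exhaust enat_ord_simps(1))
  then show ?thesis by simp
qed (use assms[of "the_enat x"] in simp)

text \<open>A strictly monotone map \<open>f\<close> from the ideals between \<open>B\<close> and
  \<open>A\<close> to ideals carries chains to chains. Images, preimages and sums are later inserted
  for \<open>f\<close>.\<close>

lemma ideal_length_transport:
  assumes "B \<subseteq> A"
    and "\<And>N. ideal N R \<Longrightarrow> B \<subseteq> N \<Longrightarrow> N \<subseteq> A \<Longrightarrow> ideal (f N) R"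
    and "\<And>N N'. ideal N R \<Longrightarrow> ideal N' R \<Longrightarrow> B \<subseteq> N \<Longrightarrow> N \<subset> N' \<Longrightarrow> N' \<subseteq> A \<Longrightarrow> f N \<subset> f N'"
    and "ideal B R" "B' \<subseteq> f B" "\<And>N. ideal N R \<Longrightarrow> B \<subseteq> N \<Longrightarrow> N \<subseteq> A \<Longrightarrow> f N \<subseteq> A'"
  shows "ideal_length R A B \<le> ideal_length R A' B'"
proof (rule enat_leI)
  have chain: "ideal_chain R n A' (f N)"
    if "ideal_chain R n A N" "ideal N R" "B \<subseteq> N" for n N
    using that
  proof (induction n arbitrary: N)
    case 0
    then show ?case using assms(6) by auto
  next
    case (Suc n)
    then obtain C where C: "ideal C R" "N \<subset> C" "ideal_chain R n A C" by auto
    then have "C \<subseteq> A" using ideal_chain_subset by metis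
    moreover have "B \<subseteq> C" using C Suc.prems by auto
    ultimately have "ideal (f C) R" "f N \<subset> f C" "ideal_chain R n A' (f C)"
      using C Suc assms(2)[of C] assms(3)[of N C] by auto
    then show ?case by auto
  qed
  fix n
  assume "enat n \<le> ideal_length R A B"
  then have "ideal_chain R n A B" using ideal_chain_iff[OF assms(1)] by blast
  from chain[OF this assms(4)] have "ideal_chain R n A' B'"
    using ideal_chain_mono assms(5) by blast
  then show "enat n \<le> ideal_length R A' B'" by (rule le_ideal_length)
qed

lemma ideal_length_mono:
  assumes "B \<subseteq> A" "A \<subseteq> A'" "B' \<subseteq> B"
  shows "ideal_length R A B \<le> ideal_length R A' B'"
proof (rule enat_leI)
  fix n assume "enat n \<le> ideal_length R A B"
  then have "ideal_chain R n A B" by (simp only: ideal_chain_iff[OF assms(1)])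
  then show "enat n \<le> ideal_length R A' B'"
    by (intro le_ideal_length ideal_chain_mono[OF _ assms(2,3)])
qed

lemma one_le_ideal_length:
  assumes "ideal A R" "B \<subset> A"
  shows "1 \<le> ideal_length R A B"
  using le_ideal_length[of R 1 A B] assms by (auto simp: one_enat_def)

lemma ideal_length_self [simp]: "ideal_length R A A = 0"
proof -
  have "n = 0" if "ideal_chain R n A A" for n
    using that by (cases n) (auto dest: ideal_chain_subset)
  then have "ideal_length R A A \<le> 0"
    unfolding ideal_length_def zero_enat_def by (auto intro!: Sup_least)
  then show ?thesis by simp
qed

text \<open>Translates the recursive chains into the indexed ones that \<open>module_length\<close>
  counts, for the comparison with \<open>embedding_dim\<close>.\<close>

lemma ideal_chain_function:
  assumes "ideal_chain R n A B" "ideal B R"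
  shows "\<exists>N. N 0 = B \<and> (\<forall>i\<le>n. ideal (N i) R \<and> B \<subseteq> N i \<and> N i \<subseteq> A) \<and> (\<forall>i<n. N i \<subset> N (Suc i))"
  using assms
proof (induction n arbitrary: B)
  case 0
  then show ?case by (intro exI[of _ "\<lambda>_. B"]) auto
next
  case (Suc n)
  then obtain C where C: "ideal C R" "B \<subset> C" "ideal_chain R n A C" by auto
  from Suc.IH[OF C(3,1)] obtain N where N: "N 0 = C"
    "\<And>i. i \<le> n \<Longrightarrow> ideal (N i) R \<and> C \<subseteq> N i \<and> N i \<subseteq> A" "\<And>i. i < n \<Longrightarrow> N i \<subset> N (Suc i)" by auto
  have BA: "B \<subseteq> A" using ideal_chain_subset[OF Suc.prems(1)] .
  define N' where "N' i = (case i of 0 \<Rightarrow> B | Suc j \<Rightarrow> N j)" for i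
  have "ideal (N' i) R \<and> B \<subseteq> N' i \<and> N' i \<subseteq> A" if "i \<le> Suc n" for i
    using that N(2)[of "i - 1"] C(2) Suc.prems(2) BA by (cases i) (auto simp: N'_def)
  moreover have "N' i \<subset> N' (Suc i)" if "i < Suc n" for i
    using that N(1) N(3)[of "i - 1"] C(2) by (cases i) (auto simp: N'_def)
  ultimately show ?case by (intro exI[of _ N']) (auto simp: N'_def)
qed

text \<open>Finiteness of \<open>h\<close> makes all four summands finite, so subtraction is
  legitimate. In use, \<open>h\<close> is the length of a module and \<open>w\<close>,
  \<open>x\<close> are the lengths of kernel and cokernel of an endomorphism.\<close>

lemma enat_cancel:
  fixes h w x y z :: enat
  assumes "h \<noteq> \<infinity>" "h = x + y" "h = z + w" "y \<le> z"
  shows "w \<le> x"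
proof -
  obtain i j k l where "x = enat i" "y = enat j" "z = enat k" "w = enat l"
    using assms(1-3) by (metis not_enat_eq plus_enat_simps(2,3))
  with assms show ?thesis by simp
qed

section \<open>Sums of ideals, the modular law and additivity of length\<close>

context cring
begin

lemma idealI_comm:
  assumes "I \<subseteq> carrier R" "\<zero> \<in> I" "\<And>x y. x \<in> I \<Longrightarrow> y \<in> I \<Longrightarrow> x \<oplus> y \<in> I"
    and "\<And>r x. r \<in> carrier R \<Longrightarrow> x \<in> I \<Longrightarrow> r \<otimes> x \<in> I"
  shows "ideal I R"
proof (rule idealI[OF ring_axioms])
  show "subgroup I (add_monoid R)"
  proof (rule add.subgroupI)
    show "\<ominus> x \<in> I" if "x \<in> I" for x
    proof -
      have "x \<in> carrier R" using that assms(1) by auto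
      then have "\<ominus> x = (\<ominus> \<one>) \<otimes> x" by (simp add: l_minus)
      then show ?thesis using assms(4) that by simp
    qed
  qed (use assms in auto)
  show "x \<otimes> a \<in> I" if "a \<in> I" "x \<in> carrier R" for a x
    using assms(4) that by blast
  show "a \<otimes> x \<in> I" if "a \<in> I" "x \<in> carrier R" for a x
    using assms(4)[of x a] subsetD[OF assms(1), of a] m_comm[of a x] that by simp
qed

lemma ideal_zero: "ideal I R \<Longrightarrow> \<zero> \<in> I"
  by (simp add: additive_subgroup.zero_closed ideal.axioms(1))

lemma ideal_add: "ideal I R \<Longrightarrow> x \<in> I \<Longrightarrow> y \<in> I \<Longrightarrow> x \<oplus> y \<in> I"
  by (simp add: additive_subgroup.a_closed ideal.axioms(1))

lemma ideal_diff: "ideal I R \<Longrightarrow> x \<in> I \<Longrightarrow> y \<in> I \<Longrightarrow> x \<ominus> y \<in> I"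
  by (simp add: a_minus_def additive_subgroup.a_closed additive_subgroup.a_inv_closed ideal.axioms(1))

lemma ideal_subset: "ideal I R \<Longrightarrow> I \<subseteq> carrier R"
  by (rule subsetI) (rule ideal.Icarr)

lemma mem_set_add: "x \<in> I <+> J \<longleftrightarrow> (\<exists>i\<in>I. \<exists>j\<in>J. x = i \<oplus> j)"
  by (auto simp: set_add_def')

lemma subset_set_add:
  assumes "ideal I R" "ideal J R"
  shows "I \<subseteq> I <+> J" "J \<subseteq> I <+> J"
proof -
  show "I \<subseteq> I <+> J"
  proof
    fix x assume "x \<in> I"
    then have "x = x \<oplus> \<zero>" using ideal.Icarr[OF assms(1)] by simp
    then show "x \<in> I <+> J" using \<open>x \<in> I\<close> ideal_zero[OF assms(2)] mem_set_add by blast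
  qed
  show "J \<subseteq> I <+> J"
  proof
    fix x assume "x \<in> J"
    then have "x = \<zero> \<oplus> x" using ideal.Icarr[OF assms(2)] by simp
    then show "x \<in> I <+> J" using \<open>x \<in> J\<close> ideal_zero[OF assms(1)] mem_set_add by blast
  qed
qed

lemma set_add_least:
  assumes "ideal K R" "I \<subseteq> K" "J \<subseteq> K"
  shows "I <+> J \<subseteq> K"
  using ideal_add[OF assms(1)] subsetD[OF assms(2)] subsetD[OF assms(3)]
  by (fastforce simp: mem_set_add)

text \<open>For \<open>x = i \<oplus> b\<close> in \<open>J\<close>, the element
  \<open>b = x \<ominus> i\<close> lies in \<open>J \<inter> B = I \<inter> B\<close>. Hence along a
  strict inclusion the intersection with \<open>B\<close> or the sum with \<open>B\<close> must
  grow.\<close>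

lemma ideal_modular:
  assumes "ideal I R" "ideal J R" "ideal B R" "I \<subseteq> J" "I \<inter> B = J \<inter> B" "I <+> B = J <+> B"
  shows "I = J"
proof
  show "J \<subseteq> I"
  proof
    fix x assume x: "x \<in> J"
    then have "x \<in> I <+> B" using subset_set_add[OF assms(2,3)] assms(6) by auto
    then obtain i b where ib: "i \<in> I" "b \<in> B" "x = i \<oplus> b" by (auto simp: mem_set_add)
    have c: "i \<in> carrier R" "b \<in> carrier R"
      using ib ideal.Icarr[OF assms(1)] ideal.Icarr[OF assms(3)] by auto
    have "b = x \<ominus> i"
      using c unfolding ib(3) a_minus_def by (simp add: a_comm[of i b] a_assoc r_neg)
    then have "b \<in> J" using ideal_diff[OF assms(2) x] ib(1) assms(4) by auto
    then have "b \<in> I" using ib assms(5) by auto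
    then show "x \<in> I" using ib ideal_add[OF assms(1)] by auto
  qed
qed (fact assms)

text \<open>By the modular law every step \<open>C \<subset> D\<close> enlarges
  \<open>C \<inter> B\<close> or \<open>C <+> B\<close>, and it is counted in the chain below or
  above \<open>B\<close> accordingly. This is the counting argument behind the Jordan-Hoelder
  theorem.\<close>

lemma ideal_chain_split:
  assumes "ideal_chain R n A C" "ideal A R" "ideal B R" "ideal C R" "B \<subseteq> A"
  shows "\<exists>k l. n \<le> k + l \<and> ideal_chain R k A (C <+> B) \<and> ideal_chain R l B (C \<inter> B)"
  using assms
proof (induction n arbitrary: C)
  case 0
  then have "C <+> B \<subseteq> A" by (intro set_add_least) auto
  then show ?case by (intro exI[of _ 0]) auto
next
  case (Suc n)
  then obtain D where D: "ideal D R" "C \<subset> D" "ideal_chain R n A D" by auto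
  with Suc obtain k l where kl: "n \<le> k + l" "ideal_chain R k A (D <+> B)"
    "ideal_chain R l B (D \<inter> B)" by metis
  have sub: "C <+> B \<subseteq> D <+> B" using D(2) unfolding set_add_def' by blast
  show ?case
  proof (cases "C \<inter> B = D \<inter> B")
    case False
    then have "C \<inter> B \<subset> D \<inter> B" using D(2) by auto
    moreover have "ideal (D \<inter> B) R" using D(1) Suc.prems i_intersect by blast
    ultimately have "ideal_chain R (Suc l) B (C \<inter> B)" using kl by auto
    moreover have "ideal_chain R k A (C <+> B)" using kl(2) sub ideal_chain_mono by blast
    ultimately show ?thesis using kl(1) by (metis add_Suc_right Suc_le_mono)
  next
    case True
    with D Suc.prems have "C <+> B \<noteq> D <+> B"
      using ideal_modular[of C D B] by auto
    with sub have "C <+> B \<subset> D <+> B" by auto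
    moreover have "ideal (D <+> B) R" using D(1) Suc.prems add_ideals by blast
    ultimately have "ideal_chain R (Suc k) A (C <+> B)" using kl by auto
    moreover have "ideal_chain R l B (C \<inter> B)" using kl(3) True by simp
    ultimately show ?thesis using kl(1) by (metis add_Suc Suc_le_mono)
  qed
qed

text \<open>Splitting a chain at \<open>B\<close> gives one inequality, concatenating a chain below
  \<open>B\<close> with one above \<open>B\<close> the other. In the latter the length of
  \<open>A/C\<close> may be taken finite, so that both summands are attained by chains.\<close>

lemma ideal_length_additive:
  assumes "ideal A R" "ideal B R" "ideal C R" "C \<subseteq> B" "B \<subseteq> A"
  shows "ideal_length R A C = ideal_length R A B + ideal_length R B C"
proof (rule antisym)
  have "C <+> B \<subseteq> B" by (rule set_add_least[OF assms(2,4) order_refl])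
  with subset_set_add(2)[OF assms(3,2)] have eq: "C <+> B = B" "C \<inter> B = C"
    using assms(4) by blast+
  show "ideal_length R A C \<le> ideal_length R A B + ideal_length R B C"
  proof (rule enat_leI)
    fix n assume "enat n \<le> ideal_length R A C"
    moreover have "C \<subseteq> A" using assms(4,5) by simp
    ultimately have "ideal_chain R n A C" by (simp only: ideal_chain_iff)
    from ideal_chain_split[OF this assms(1,2,3,5)] obtain k l
      where kl: "n \<le> k + l" "ideal_chain R k A B" "ideal_chain R l B C"
      unfolding eq by auto
    have "enat n \<le> enat k + enat l" using kl(1) by simp
    also have "\<dots> \<le> ideal_length R A B + ideal_length R B C"
      using kl by (intro add_mono le_ideal_length)
    finally show "enat n \<le> ideal_length R A B + ideal_length R B C" .
  qed
  show "ideal_length R A B + ideal_length R B C \<le> ideal_length R A C"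
  proof (cases "ideal_length R A C")
    case (enat c)
    have fin: "ideal_length R A B \<le> enat c" "ideal_length R B C \<le> enat c"
      using ideal_length_mono[of B A A C R] ideal_length_mono[of C B A C R] assms enat by auto
    then obtain k l where kl: "ideal_length R A B = enat k" "ideal_length R B C = enat l"
      by (metis enat_ile)
    then have "ideal_chain R k A B" "ideal_chain R l B C"
      by (simp_all add: ideal_chain_iff[OF assms(5)] ideal_chain_iff[OF assms(4)])
    from le_ideal_length[OF ideal_chain_concat[OF this(2,1)]] show ?thesis
      by (simp add: kl add.commute)
  qed simp
qed

section \<open>Lengths under multiplication by an element and under sums\<close>

lemma annihilator_ideal:
  assumes "Z \<subseteq> carrier R"
  shows "ideal (annihilator R Z) R"
  by (rule idealI_comm) (use assms in \<open>auto simp: annihilator_def l_distr m_assoc subset_iff\<close>)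

text \<open>The kernel of multiplication by \<open>x\<close> on \<open>J\<close> is
  \<open>J \<inter> annihilator R {x}\<close>, and taking images is strictly monotone on the ideals
  that contain the kernel.\<close>

lemma ideal_length_mult:
  assumes "ideal J R" "x \<in> carrier R"
  shows "ideal_length R J (J \<inter> annihilator R {x}) \<le> ideal_length R ((\<lambda>y. y \<otimes> x) ` J) {\<zero>}"
proof (rule ideal_length_transport[where f = "\<lambda>N. (\<lambda>y. y \<otimes> x) ` N"])
  have annid: "ideal (annihilator R {x}) R" using annihilator_ideal assms(2) by simp
  then show id: "ideal (J \<inter> annihilator R {x}) R" using assms(1) i_intersect by blast
  show "ideal ((\<lambda>y. y \<otimes> x) ` N) R" if N: "ideal N R" for N
  proof (rule idealI_comm)
    show "(\<lambda>y. y \<otimes> x) ` N \<subseteq> carrier R" using ideal.Icarr[OF N] assms(2) by auto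
    show "\<zero> \<in> (\<lambda>y. y \<otimes> x) ` N" using ideal_zero[OF N] assms(2) by force
  next
    fix u v assume "u \<in> (\<lambda>y. y \<otimes> x) ` N" "v \<in> (\<lambda>y. y \<otimes> x) ` N"
    then obtain y z where yz: "y \<in> N" "z \<in> N" "u = y \<otimes> x" "v = z \<otimes> x" by auto
    then have "u \<oplus> v = (y \<oplus> z) \<otimes> x" using ideal.Icarr[OF N] assms(2) by (simp add: l_distr)
    then show "u \<oplus> v \<in> (\<lambda>y. y \<otimes> x) ` N" using ideal_add[OF N yz(1,2)] by blast
  next
    fix r v assume r: "r \<in> carrier R" "v \<in> (\<lambda>y. y \<otimes> x) ` N"
    then obtain z where z: "z \<in> N" "v = z \<otimes> x" by auto
    then have "r \<otimes> v = (r \<otimes> z) \<otimes> x" using ideal.Icarr[OF N] assms(2) r by (simp add: m_assoc)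
    then show "r \<otimes> v \<in> (\<lambda>y. y \<otimes> x) ` N" using ideal.I_l_closed[OF N z(1) r(1)] by blast
  qed
  show "(\<lambda>y. y \<otimes> x) ` N \<subset> (\<lambda>y. y \<otimes> x) ` N'"
    if N: "ideal N R" "ideal N' R" "J \<inter> annihilator R {x} \<subseteq> N" "N \<subset> N'" "N' \<subseteq> J" for N N'
  proof
    show "(\<lambda>y. y \<otimes> x) ` N \<subseteq> (\<lambda>y. y \<otimes> x) ` N'" using N(4) by auto
    obtain y where y: "y \<in> N'" "y \<notin> N" using N(4) by auto
    \<comment> \<open>An equality \<open>y \<otimes> x = z \<otimes> x\<close> puts
      \<open>y \<ominus> z\<close> into the kernel, which \<open>N\<close> contains, and hence
      \<open>y\<close> into \<open>N\<close>.\<close>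
    have "y \<otimes> x \<notin> (\<lambda>y. y \<otimes> x) ` N"
    proof
      assume "y \<otimes> x \<in> (\<lambda>y. y \<otimes> x) ` N"
      then obtain z where z: "z \<in> N" "y \<otimes> x = z \<otimes> x" by auto
      have c: "y \<in> carrier R" "z \<in> carrier R"
        using ideal.Icarr[OF N(2) y(1)] ideal.Icarr[OF N(1) z(1)] by auto
      then have "(y \<ominus> z) \<otimes> x = y \<otimes> x \<ominus> z \<otimes> x"
        using assms(2) by algebra
      also have "\<dots> = \<zero>" using z c assms(2) by (simp add: r_neg a_minus_def)
      finally have "y \<ominus> z \<in> annihilator R {x}" using c by (simp add: annihilator_def)
      moreover have "y \<ominus> z \<in> J" using y z N(4,5) ideal_diff[OF assms(1)] by blast
      ultimately have "y \<ominus> z \<in> N" using N(3) by auto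
      then have "z \<oplus> (y \<ominus> z) \<in> N" using z ideal_add[OF N(1)] by simp
      moreover have "z \<oplus> (y \<ominus> z) = y" using c by algebra
      ultimately show False using y by simp
    qed
    then show "(\<lambda>y. y \<otimes> x) ` N \<noteq> (\<lambda>y. y \<otimes> x) ` N'" using y by blast
  qed
  show "{\<zero>} \<subseteq> (\<lambda>y. y \<otimes> x) ` (J \<inter> annihilator R {x})"
    using ideal_zero[OF id] assms(2) by force
qed auto

text \<open>Preimages are strictly monotone here because the ideals in the chain consist of
  multiples \<open>y \<otimes> x\<close> with \<open>y \<in> J\<close>.\<close>

lemma ideal_length_mult_ge:
  assumes "ideal J R" "x \<in> carrier R"
  shows "ideal_length R ((\<lambda>y. y \<otimes> x) ` J) {\<zero>} \<le> ideal_length R J (J \<inter> annihilator R {x})"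
proof (rule ideal_length_transport[where f = "\<lambda>N. {y \<in> J. y \<otimes> x \<in> N}"])
  have carr: "y \<in> carrier R" if "y \<in> J" for y using that ideal.Icarr[OF assms(1)] by auto
  show "ideal {\<zero>} R" by (rule zeroideal)
  show "{\<zero>} \<subseteq> (\<lambda>y. y \<otimes> x) ` J" using ideal_zero[OF assms(1)] assms(2) by force
  show "ideal {y \<in> J. y \<otimes> x \<in> N} R" if N: "ideal N R" for N
    by (rule idealI_comm)
      (use carr assms ideal_zero[OF N] ideal_zero[OF assms(1)] ideal_add[OF N] ideal_add[OF assms(1)]
        ideal.I_l_closed[OF N] ideal.I_l_closed[OF assms(1)] in \<open>auto simp: l_distr m_assoc\<close>)
  show "{y \<in> J. y \<otimes> x \<in> N} \<subset> {y \<in> J. y \<otimes> x \<in> N'}"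
    if "N \<subset> N'" "N' \<subseteq> (\<lambda>y. y \<otimes> x) ` J" for N N'
    using that by blast
  show "J \<inter> annihilator R {x} \<subseteq> {y \<in> J. y \<otimes> x \<in> {\<zero>}}"
    by (auto simp: annihilator_def)
qed auto

text \<open>Half of the second isomorphism theorem, on lengths: all ideals in the chain have the
  same intersection with \<open>J\<close>, so the modular law makes adding \<open>J\<close> strictly
  monotone.\<close>

lemma ideal_length_set_add_ge:
  assumes "ideal I R" "ideal J R"
  shows "ideal_length R I (I \<inter> J) \<le> ideal_length R (I <+> J) J"
proof (rule ideal_length_transport[where f = "\<lambda>N. N <+> J"])
  show id: "ideal (I \<inter> J) R" using assms i_intersect by blast
  show "ideal (N <+> J) R" if "ideal N R" for N using that assms add_ideals by blast
  show "J \<subseteq> (I \<inter> J) <+> J" using subset_set_add[OF id assms(2)] by simp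
  show mono: "N <+> J \<subseteq> I <+> J" if "N \<subseteq> I" for N using that unfolding set_add_def' by blast
  show "N <+> J \<subset> N' <+> J"
    if N: "ideal N R" "ideal N' R" "I \<inter> J \<subseteq> N" "N \<subset> N'" "N' \<subseteq> I" for N N'
  proof -
    have "N <+> J \<subseteq> N' <+> J" using N(4) unfolding set_add_def' by blast
    moreover have "N \<inter> J = N' \<inter> J" using N by auto
    ultimately show ?thesis using ideal_modular[OF N(1,2) assms(2)] N(4) by auto
  qed
qed auto

subsection \<open>Noetherian rings\<close>

text \<open>In a Noetherian ring the union of a nonempty chain of ideals belongs to the chain, so
  Zorn's lemma applies to every nonempty family of ideals, whatever property defines it.\<close>

lemma noetherian_maximal_element:
  assumes "noetherian_ring R" "J \<in> S" "\<And>I. I \<in> S \<Longrightarrow> ideal I R"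
  shows "\<exists>M\<in>S. \<forall>I\<in>S. M \<subseteq> I \<longrightarrow> I = M"
proof (rule subset_Zorn_nonempty)
  fix C assume C: "C \<noteq> {}" "subset.chain S C"
  then have "subset.chain {I. ideal I R} C"
    using assms(3) by (auto simp: pred_on.chain_def)
  then have "\<Union>C \<in> C"
    using noetherian_ring.ideal_chain_is_trivial[OF assms(1) C(1)] by blast
  then show "\<Union>C \<in> S" using C(2) by (auto simp: pred_on.chain_def)
qed (use assms(2) in auto)

lemma ideal_power_ideal:
  assumes "ideal I R"
  shows "ideal (ideal_power R I n) R"
  by (induction n) (use assms in \<open>auto intro: oneideal ideal_prod_is_ideal\<close>)

lemma ideal_power_add:
  assumes "ideal I R"
  shows "ideal_power R I (m + n) = ideal_prod R (ideal_power R I m) (ideal_power R I n)"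
proof (induction m)
  case 0
  show ?case
    using ideal_prod_one ideal_prod_commute oneideal ideal_power_ideal[OF assms] by (metis add_0 ideal_power.simps(1))
next
  case (Suc m)
  then show ?case
    using assms ideal_prod_assoc ideal_power_ideal[OF assms] by simp
qed

lemma ideal_power_2:
  assumes "ideal I R"
  shows "ideal_power R I 2 = ideal_prod R I I"
  using ideal_prod_one[OF assms] by (simp add: numeral_2_eq_2)

lemma ideal_prod_subset:
  assumes "ideal K R" "\<And>x y. x \<in> I \<Longrightarrow> y \<in> J \<Longrightarrow> x \<otimes> y \<in> K"
  shows "ideal_prod R I J \<subseteq> K"
proof
  fix z assume "z \<in> ideal_prod R I J"
  then show "z \<in> K"
    by (induction z) (use assms ideal_add[OF assms(1)] in auto)
qed

lemma ideal_colon: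
  assumes "ideal J R" "z \<in> carrier R"
  shows "ideal {y \<in> carrier R. y \<otimes> z \<in> J} R"
  by (rule idealI_comm)
    (use assms ideal_zero[OF assms(1)] ideal_add[OF assms(1)] ideal.I_l_closed[OF assms(1)]
      in \<open>auto simp: l_distr m_assoc\<close>)

lemma mem_add_PIdl: "y \<in> N <+> PIdl x \<longleftrightarrow> (\<exists>b\<in>N. \<exists>r\<in>carrier R. y = b \<oplus> r \<otimes> x)"
  by (auto simp: mem_set_add cgenideal_def)

lemma subset_add_PIdl:
  assumes "ideal N R" "x \<in> carrier R"
  shows "ideal (N <+> PIdl x) R" "N \<subseteq> N <+> PIdl x" "x \<in> N <+> PIdl x"
    and "ideal M R \<Longrightarrow> N \<subseteq> M \<Longrightarrow> x \<in> M \<Longrightarrow> N <+> PIdl x \<subseteq> M"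
proof -
  have P: "ideal (PIdl x) R" using assms(2) by (rule cgenideal_ideal)
  then show "ideal (N <+> PIdl x) R" using assms(1) by (rule add_ideals[rotated])
  show "N \<subseteq> N <+> PIdl x" "x \<in> N <+> PIdl x"
    using subset_set_add[OF assms(1) P] cgenideal_self[OF assms(2)] by auto
  show "N <+> PIdl x \<subseteq> M" if "ideal M R" "N \<subseteq> M" "x \<in> M"
    using set_add_least[OF that(1,2) cgenideal_minimal[OF that(1,3)]] .
qed

text \<open>Noetherian induction replaces a choice of generators. For an ideal \<open>M\<close>
  maximal among the counterexamples, some \<open>z \<notin> M\<close> makes both the colon ideal
  \<open>M : z\<close> and \<open>M + (z)\<close> strictly larger. Both then contain powers of
  \<open>I\<close>, and the product of these powers falls into \<open>M\<close>.\<close>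

lemma ideal_power_subset:
  assumes noeth: "noetherian_ring R" and m: "ideal I R" and J: "ideal J R"
    and nilp: "\<And>y. y \<in> I \<Longrightarrow> \<exists>n::nat. y [^] n \<in> J"
  obtains s where "ideal_power R I s \<subseteq> J"
proof (rule ccontr)
  define S where "S = {K. ideal K R \<and> J \<subseteq> K \<and> (\<forall>s. \<not> ideal_power R I s \<subseteq> K)}"
  assume "\<not> thesis"
  with that J have "J \<in> S" by (auto simp: S_def)
  then have "\<exists>M\<in>S. \<forall>K\<in>S. M \<subseteq> K \<longrightarrow> K = M"
    by (rule noetherian_maximal_element[OF noeth]) (simp add: S_def)
  then obtain M where MS: "M \<in> S" and "\<forall>K\<in>S. M \<subseteq> K \<longrightarrow> K = M" ..
  then have max: "K = M" if "K \<in> S" "M \<subseteq> K" for K using that by simp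
  have M: "ideal M R" "J \<subseteq> M" and no: "\<And>s. \<not> ideal_power R I s \<subseteq> M"
    using MS by (auto simp: S_def)
  have larger: "\<exists>s. ideal_power R I s \<subseteq> K" if "ideal K R" "M \<subset> K" for K
  proof (rule ccontr)
    assume "\<nexists>s. ideal_power R I s \<subseteq> K"
    then have "K \<in> S" using that M(2) by (auto simp: S_def)
    then have "K = M" using that(2) by (intro max) auto
    then show False using that(2) by simp
  qed
  have "\<not> I \<subseteq> M" using no[of 1] ideal_prod_one[OF m] by simp
  then obtain y where y: "y \<in> I" "y \<notin> M" by auto
  have yc: "y \<in> carrier R" using ideal.Icarr[OF m y(1)] .
  define n where "n = (LEAST n::nat. y [^] n \<in> M)"
  obtain l :: nat where "y [^] l \<in> J" using nilp[OF y(1)] by auto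
  then have "y [^] l \<in> M" using M(2) by auto
  then have n: "y [^] n \<in> M" unfolding n_def by (rule LeastI)
  have "n \<noteq> 0"
  proof
    assume "n = 0"
    with n have "M = carrier R" using ideal.one_imp_carrier[OF M(1)] by simp
    then show False using no[of 0] by simp
  qed
  then obtain k where k: "n = Suc k" using not0_implies_Suc by auto
  \<comment> \<open>The exponent \<open>n\<close> is minimal with \<open>y [^] n \<in> M\<close>, so
    its predecessor \<open>k\<close> gives \<open>z \<notin> M\<close> although
    \<open>y \<otimes> z \<in> M\<close>.\<close>
  define z where "z = y [^] k"
  have zM: "z \<notin> M" unfolding z_def using not_less_Least[of k "\<lambda>n. y [^] n \<in> M"] k n_def by auto
  have zc: "z \<in> carrier R" using yc by (simp add: z_def)
  have "y \<otimes> z \<in> M" using n k yc by (simp add: z_def m_comm)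
  with yc y have "M \<noteq> {w \<in> carrier R. w \<otimes> z \<in> M}" by auto
  moreover have "M \<subseteq> {w \<in> carrier R. w \<otimes> z \<in> M}"
    using ideal.Icarr[OF M(1)] ideal.I_r_closed[OF M(1)] zc by auto
  ultimately obtain t where t: "ideal_power R I t \<subseteq> {w \<in> carrier R. w \<otimes> z \<in> M}"
    using larger[OF ideal_colon[OF M(1) zc]] by auto
  have "M \<subset> M <+> PIdl z" using subset_add_PIdl(2,3)[OF M(1) zc] zM by auto
  then obtain s where s: "ideal_power R I s \<subseteq> M <+> PIdl z"
    using larger[OF subset_add_PIdl(1)[OF M(1) zc]] by auto
  have "ideal_power R I (t + s) \<subseteq> M"
    unfolding ideal_power_add[OF m]
  proof (rule ideal_prod_subset[OF M(1)])
    fix u v assume u: "u \<in> ideal_power R I t" and v: "v \<in> ideal_power R I s"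
    have "v \<in> M <+> PIdl z" using subsetD[OF s v] .
    then obtain w r where w: "w \<in> M" "r \<in> carrier R" "v = w \<oplus> r \<otimes> z"
      unfolding mem_add_PIdl by blast
    have uc: "u \<in> carrier R" "u \<otimes> z \<in> M" using t u by auto
    have wc: "w \<in> carrier R" using ideal.Icarr[OF M(1) w(1)] .
    \<comment> \<open>The first summand lies in \<open>M\<close> because \<open>w\<close> does, the
      second because \<open>u\<close> lies in the colon ideal of \<open>z\<close>.\<close>
    have "u \<otimes> v = u \<otimes> w \<oplus> r \<otimes> (u \<otimes> z)"
      unfolding w(3) using uc(1) wc w(2) zc by (simp add: r_distr m_lcomm)
    also have "\<dots> \<in> M"
      using ideal_add[OF M(1)] ideal.I_l_closed[OF M(1)] uc w by simp
    finally show "u \<otimes> v \<in> M" .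
  qed
  then show False using no by blast
qed

section \<open>Finite length of subquotients killed by the maximal ideal\<close>

lemma ideal_length_cyclic:
  assumes "maximalideal \<mm> R" "ideal B R" "x \<in> carrier R" "\<And>y. y \<in> \<mm> \<Longrightarrow> y \<otimes> x \<in> B"
  shows "ideal_length R (B <+> PIdl x) B \<le> 1"
proof -
  interpret maximalideal \<mm> R by fact
  \<comment> \<open>The quotient \<open>(B + (x))/B\<close> is cyclic and killed by
    \<open>\<mm>\<close>, hence zero or a copy of the residue field. So an ideal strictly above
    \<open>B\<close> is everything.\<close>
  have all: "B <+> PIdl x \<subseteq> N" if N: "ideal N R" "B \<subset> N" "N \<subseteq> B <+> PIdl x" for N
  proof -
    obtain y where y: "y \<in> N" "y \<notin> B" using N(2) by auto
    have "y \<in> B <+> PIdl x" using subsetD[OF N(3) y(1)] .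
    then obtain b r where br: "b \<in> B" "r \<in> carrier R" "y = b \<oplus> r \<otimes> x"
      unfolding mem_add_PIdl by blast
    have bc: "b \<in> carrier R" using ideal.Icarr[OF assms(2) br(1)] .
    have rm: "r \<notin> \<mm>"
    proof
      assume "r \<in> \<mm>"
      then have "y \<in> B" using br assms(4) ideal_add[OF assms(2)] by simp
      then show False using y by simp
    qed
    have "\<mm> <+> PIdl r \<subseteq> carrier R"
      using subset_add_PIdl(1)[OF is_ideal br(2)] by (rule ideal_subset)
    then have "\<mm> <+> PIdl r = carrier R"
      using I_maximal[OF subset_add_PIdl(1)[OF is_ideal br(2)] subset_add_PIdl(2)[OF is_ideal br(2)]]
        subset_add_PIdl(3)[OF is_ideal br(2)] rm by auto
    \<comment> \<open>A coefficient outside \<open>\<mm>\<close> is invertible modulo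
      \<open>\<mm>\<close>: \<open>s\<close> inverts \<open>r\<close> up to the error
      \<open>u\<close>, and \<open>u \<otimes> x\<close> lies in \<open>B\<close>.\<close>
    then have "\<one> \<in> \<mm> <+> PIdl r" by simp
    then obtain u s where us: "u \<in> \<mm>" "s \<in> carrier R" "\<one> = u \<oplus> s \<otimes> r"
      unfolding mem_add_PIdl by blast
    have uc: "u \<in> carrier R" using Icarr us(1) .
    have "r \<otimes> x = y \<ominus> b"
      unfolding br(3) a_minus_def using bc br(2) assms(3)
      by (simp add: a_comm[of b] a_assoc r_neg)
    also have "\<dots> \<in> N" using ideal_diff[OF N(1) y(1)] br(1) N(2) by auto
    finally have rx: "r \<otimes> x \<in> N" .
    have "x = (u \<oplus> s \<otimes> r) \<otimes> x" using assms(3) us(3)[symmetric] by simp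
    also have "\<dots> = u \<otimes> x \<oplus> s \<otimes> (r \<otimes> x)"
      using uc us(2) br(2) assms(3) by (simp add: l_distr m_assoc)
    also have "\<dots> \<in> N"
      using ideal_add[OF N(1)] ideal.I_l_closed[OF N(1) rx us(2)] assms(4)[OF us(1)] N(2) by auto
    finally have "x \<in> N" .
    then show ?thesis using subset_add_PIdl(4)[OF assms(2,3) N(1)] N(2) by auto
  qed
  have "n \<le> 1" if "ideal_chain R n (B <+> PIdl x) B" for n
  proof (rule ccontr)
    assume "\<not> n \<le> 1"
    then have "ideal_chain R (Suc (Suc 0)) (B <+> PIdl x) B"
      using that ideal_chain_le[of R n _ _ "Suc (Suc 0)"] by simp
    then obtain C D where "ideal C R" "B \<subset> C" and CD: "C \<subset> D" "D \<subseteq> B <+> PIdl x" by auto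
    then have "B <+> PIdl x \<subseteq> C" by (intro all) auto
    then show False using CD by auto
  qed
  then show ?thesis
    unfolding ideal_length_def by (auto intro!: Sup_least simp: one_enat_def)
qed

text \<open>Take an ideal maximal among those between \<open>B\<close> and \<open>A\<close> of
  finite length over \<open>B\<close>. Adjoining a further element of \<open>A\<close> would add at
  most 1 to the length, so it is \<open>A\<close> itself.\<close>

lemma ideal_length_finite:
  assumes noeth: "noetherian_ring R" and m: "maximalideal \<mm> R"
    and AB: "ideal A R" "ideal B R" "B \<subseteq> A" and mA: "\<And>y x. y \<in> \<mm> \<Longrightarrow> x \<in> A \<Longrightarrow> y \<otimes> x \<in> B"
  shows "ideal_length R A B \<noteq> \<infinity>"
proof -
  define S where "S = {N. ideal N R \<and> B \<subseteq> N \<and> N \<subseteq> A \<and> ideal_length R N B \<noteq> \<infinity>}"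
  have "B \<in> S" using AB by (simp add: S_def zero_enat_def)
  then have "\<exists>M\<in>S. \<forall>K\<in>S. M \<subseteq> K \<longrightarrow> K = M"
    by (rule noetherian_maximal_element[OF noeth]) (simp add: S_def)
  then obtain M where MS: "M \<in> S" and "\<forall>K\<in>S. M \<subseteq> K \<longrightarrow> K = M" ..
  then have max: "K = M" if "K \<in> S" "M \<subseteq> K" for K using that by simp
  have M: "ideal M R" "B \<subseteq> M" "M \<subseteq> A" "ideal_length R M B \<noteq> \<infinity>" using MS by (auto simp: S_def)
  have "M = A"
  proof (rule ccontr)
    assume "M \<noteq> A"
    then obtain x where x: "x \<in> A" "x \<notin> M" using M by auto
    have xc: "x \<in> carrier R" using ideal.Icarr[OF AB(1) x(1)] .
    note * = subset_add_PIdl[OF M(1) xc]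
    have "ideal_length R (M <+> PIdl x) B = ideal_length R (M <+> PIdl x) M + ideal_length R M B"
      by (rule ideal_length_additive[OF *(1) M(1) AB(2) M(2) *(2)])
    moreover have "ideal_length R (M <+> PIdl x) M \<le> 1"
      by (rule ideal_length_cyclic[OF m M(1) xc]) (use mA x M(2) in auto)
    then have "ideal_length R (M <+> PIdl x) M \<noteq> \<infinity>"
      by (cases "ideal_length R (M <+> PIdl x) M") (auto simp: one_enat_def)
    ultimately have "M <+> PIdl x \<in> S"
      using * M *(4)[OF AB(1) M(3) x(1)] by (auto simp: S_def plus_eq_infty_iff_enat)
    then show False using max[of "M <+> PIdl x"] * x by auto
  qed
  then show ?thesis using M by simp
qed

text \<open>Since \<open>J\<close> maps \<open>M\<close> into \<open>K\<close>, this bounds the length of the image of \<open>J\<close> in \<open>Hom(M/N, K)\<close>.\<close>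

lemma ideal_length_annihilators:
  assumes "ideal J R" "ideal M R" "ideal N R" "ideal K R" "N \<subseteq> M"
    and "\<And>y x. y \<in> J \<Longrightarrow> x \<in> M \<Longrightarrow> y \<otimes> x \<in> K" and "ideal_length R M N = enat n"
  shows "ideal_length R (J \<inter> annihilator R N) (J \<inter> annihilator R M)
    \<le> enat n * ideal_length R K {\<zero>}"
  using assms(3,5,7)
proof (induction n arbitrary: N rule: less_induct)
  case (less n)
  show ?case
  proof (cases "N = M")
    case False
    then obtain x where x: "x \<in> M" "x \<notin> N" using less.prems by auto
    have xc: "x \<in> carrier R" using ideal.Icarr[OF assms(2) x(1)] .
    \<comment> \<open>The induction on the length of \<open>M/N\<close> adds one generator
      \<open>x\<close> to \<open>N\<close> at a time.\<close>
    define N' where "N' = N <+> PIdl x"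
    note * = subset_add_PIdl[OF less.prems(1) xc, folded N'_def]
    have N'M: "N' \<subseteq> M" using *(4)[OF assms(2) less.prems(2) x(1)] .
    have len: "enat n = ideal_length R M N' + ideal_length R N' N"
      using ideal_length_additive[OF assms(2) *(1) less.prems(1) *(2) N'M] less.prems(3) by simp
    have one: "1 \<le> ideal_length R N' N"
      by (rule one_le_ideal_length[OF *(1)]) (use * x in auto)
    obtain k l where kl: "ideal_length R M N' = enat k" "ideal_length R N' N = enat l"
      using len by (cases "ideal_length R M N'"; cases "ideal_length R N' N") auto
    then have n: "n = k + l" "1 \<le> l" using len one by (auto simp: one_enat_def)
    have IH: "ideal_length R (J \<inter> annihilator R N') (J \<inter> annihilator R M)
        \<le> enat k * ideal_length R K {\<zero>}"
      using less.IH[OF _ *(1) N'M kl(1)] n by simp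
    have sub: "N \<subseteq> carrier R" "N' \<subseteq> carrier R" "M \<subseteq> carrier R"
      using ideal_subset less.prems *(1) assms(2) by simp_all
    have ids: "ideal (J \<inter> annihilator R N) R" "ideal (J \<inter> annihilator R N') R"
      "ideal (J \<inter> annihilator R M) R"
      using sub by (auto intro!: i_intersect[OF assms(1)] annihilator_ideal)
    have ann: "J \<inter> annihilator R N' = (J \<inter> annihilator R N) \<inter> annihilator R {x}"
    proof
      show "J \<inter> annihilator R N' \<subseteq> (J \<inter> annihilator R N) \<inter> annihilator R {x}"
        using *(2,3) by (auto simp: annihilator_def)
      show "(J \<inter> annihilator R N) \<inter> annihilator R {x} \<subseteq> J \<inter> annihilator R N'"
      proof
        fix y assume y: "y \<in> (J \<inter> annihilator R N) \<inter> annihilator R {x}"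
        then have yc: "y \<in> carrier R" by (simp add: annihilator_def)
        have "y \<otimes> w = \<zero>" if w: "w \<in> N'" for w
        proof -
          obtain b r where br: "b \<in> N" "r \<in> carrier R" "w = b \<oplus> r \<otimes> x"
            using w unfolding N'_def mem_add_PIdl by blast
          have "b \<in> carrier R" using br sub by auto
          then have "y \<otimes> w = y \<otimes> b \<oplus> r \<otimes> (y \<otimes> x)"
            unfolding br(3) using yc br(2) xc by (simp add: r_distr m_lcomm)
          also have "\<dots> = \<zero>" using y br by (simp add: annihilator_def)
          finally show ?thesis .
        qed
        then show "y \<in> J \<inter> annihilator R N'" using y by (simp add: annihilator_def)
      qed
    qed
    \<comment> \<open>Multiplication by \<open>x\<close> maps
      \<open>J \<inter> annihilator R N\<close> into \<open>K\<close> with kernel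
      \<open>J \<inter> annihilator R N'\<close>, so the new generator costs at most the length of
      \<open>K\<close>.\<close>
    have "ideal_length R (J \<inter> annihilator R N) (J \<inter> annihilator R N')
      \<le> ideal_length R ((\<lambda>y. y \<otimes> x) ` (J \<inter> annihilator R N)) {\<zero>}"
      unfolding ann by (rule ideal_length_mult[OF ids(1) xc])
    also have "\<dots> \<le> ideal_length R K {\<zero>}"
    proof (rule ideal_length_mono)
      show "{\<zero>} \<subseteq> (\<lambda>y. y \<otimes> x) ` (J \<inter> annihilator R N)"
        using ideal_zero[OF ids(1)] xc by force
    qed (use assms(6) x in auto)
    finally have first: "ideal_length R (J \<inter> annihilator R N) (J \<inter> annihilator R N')
      \<le> ideal_length R K {\<zero>}" .
    have "ideal_length R (J \<inter> annihilator R N) (J \<inter> annihilator R M) =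
      ideal_length R (J \<inter> annihilator R N) (J \<inter> annihilator R N')
      + ideal_length R (J \<inter> annihilator R N') (J \<inter> annihilator R M)"
      by (rule ideal_length_additive[OF ids]) (use N'M *(2) in \<open>auto simp: annihilator_def\<close>)
    also have "\<dots> \<le> ideal_length R K {\<zero>} + enat k * ideal_length R K {\<zero>}"
      by (rule add_mono[OF first IH])
    also have "\<dots> = enat (Suc k) * ideal_length R K {\<zero>}"
      by (simp add: distrib_right eSuc_enat[symmetric] mult_eSuc)
    also have "\<dots> \<le> enat n * ideal_length R K {\<zero>}"
      using n by (intro mult_right_mono) auto
    finally show ?thesis .
  qed simp
qed

text \<open>The snake lemma for multiplication by \<open>a\<close> on \<open>0 \<rightarrow> H \<rightarrow> R \<rightarrow> R/H \<rightarrow> 0\<close>, on the level of lengths.\<close>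

lemma ideal_length_snake:
  assumes H: "ideal H R" and a: "a \<in> carrier R"
    and fin: "ideal_length R H {\<zero>} \<noteq> \<infinity>"
    and reg: "\<And>x. x \<in> carrier R \<Longrightarrow> x \<otimes> a \<in> H \<Longrightarrow> x \<in> H"
  shows "ideal_length R (carrier R) (H <+> PIdl a) + ideal_length R (annihilator R {a}) {\<zero>}
    \<le> ideal_length R (carrier R) (PIdl a)"
proof -
  define aH where "aH = (\<lambda>y. y \<otimes> a) ` H"
  have Hc: "H \<subseteq> carrier R" using ideal_subset[OF H] .
  have Pa: "ideal (PIdl a) R" using cgenideal_ideal[OF a] .
  \<comment> \<open>By \<open>reg\<close>, a multiple of \<open>a\<close> lies in \<open>H\<close>
    only if its cofactor does; this is injectivity of \<open>a\<close> on
    \<open>R/H\<close>.\<close>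
  have aH: "aH = H \<inter> PIdl a"
  proof
    show "aH \<subseteq> H \<inter> PIdl a"
      using Hc ideal.I_r_closed[OF H] a by (auto simp: aH_def cgenideal_def)
    show "H \<inter> PIdl a \<subseteq> aH" using reg by (auto simp: aH_def cgenideal_def)
  qed
  have aHid: "ideal aH R" unfolding aH by (rule i_intersect[OF H Pa])
  have zero: "{\<zero>} \<subseteq> aH" using ideal_zero[OF aHid] by simp
  have ann: "ideal (annihilator R {a}) R" using annihilator_ideal a by simp
  have annH: "annihilator R {a} \<subseteq> H"
    using reg ideal_zero[OF H] by (auto simp: annihilator_def)
  have "ideal_length R H {\<zero>} = ideal_length R H aH + ideal_length R aH {\<zero>}"
    by (rule ideal_length_additive[OF H aHid zeroideal zero]) (simp add: aH)
  moreover have "ideal_length R H {\<zero>} =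
    ideal_length R H (annihilator R {a}) + ideal_length R (annihilator R {a}) {\<zero>}"
    by (rule ideal_length_additive[OF H ann zeroideal _ annH]) (use ideal_zero[OF ann] in simp)
  moreover have "ideal_length R aH {\<zero>} \<le> ideal_length R H (annihilator R {a})"
    using ideal_length_mult_ge[OF H a] annH by (simp add: aH_def Int_absorb1)
  \<comment> \<open>Kernel \<open>0 : a\<close> and cokernel \<open>H/aH\<close> of multiplication
    by \<open>a\<close> on \<open>H\<close> are compared through the finite length of
    \<open>H\<close>.\<close>
  ultimately have "ideal_length R (annihilator R {a}) {\<zero>} \<le> ideal_length R H aH"
    by (rule enat_cancel[OF fin])
  also have "\<dots> \<le> ideal_length R (H <+> PIdl a) (PIdl a)"
    unfolding aH by (rule ideal_length_set_add_ge[OF H Pa])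
  finally have le: "ideal_length R (annihilator R {a}) {\<zero>} \<le> ideal_length R (H <+> PIdl a) (PIdl a)" .
  have "ideal_length R (carrier R) (PIdl a) =
    ideal_length R (carrier R) (H <+> PIdl a) + ideal_length R (H <+> PIdl a) (PIdl a)"
    by (rule ideal_length_additive[OF oneideal add_ideals[OF H Pa] Pa subset_set_add(2)[OF H Pa]])
      (rule ideal_subset[OF add_ideals[OF H Pa]])
  with le show ?thesis by (simp add: add_left_mono)
qed

end

section \<open>Parameters that generate an annihilator ideal\<close>

text \<open>Here \<open>t\<close> is the length of \<open>R/(aR + H)\<close>, and \<open>p\<close>,
  \<open>q\<close>, \<open>r\<close> are those of \<open>I/\<mm>I\<close>, \<open>\<mm>I\<close>,
  \<open>\<mm>/(a)\<close>. In all cases \<open>p + q \<le> 3\<close> and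
  \<open>p + q \<le> p * q\<close>, but two naturals with sum at most 3 have a product below their
  sum unless both vanish.\<close>

lemma length_arithmetic:
  fixes p q r t :: nat
  assumes "t + p + q \<le> 1 + r" "r \<le> p * q" "r \<le> 4" "1 \<le> t" "r = 4 \<Longrightarrow> 2 \<le> t"
  shows "p = 0 \<and> q = 0"
proof -
  have pq: "p + q \<le> 3" "p + q \<le> r" using assms by (cases "r = 4"; simp)+
  then have "p \<in> {0, 1, 2, 3}" "q \<in> {0, 1, 2, 3}" by auto
  then show ?thesis using pq assms(2) by auto
qed

section \<open>Units, primes and parameters in a Noetherian local ring\<close>

context local_ring
begin

text \<open>An ideal maximal among the proper ideals above \<open>I\<close> exists by the Noetherian
  condition. It is a maximal ideal of the ring, hence \<open>\<mm>\<close>.\<close>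

lemma proper_ideal_subset:
  assumes noeth: "noetherian_ring R" and "ideal I R" "\<one> \<notin> I"
  shows "I \<subseteq> \<mm>"
proof -
  define S where "S = {K. ideal K R \<and> I \<subseteq> K \<and> \<one> \<notin> K}"
  have "I \<in> S" using assms by (simp add: S_def)
  then have "\<exists>M\<in>S. \<forall>K\<in>S. M \<subseteq> K \<longrightarrow> K = M"
    by (rule noetherian_maximal_element[OF noeth]) (simp add: S_def)
  then obtain M where MS: "M \<in> S" and "\<forall>K\<in>S. M \<subseteq> K \<longrightarrow> K = M" ..
  then have max: "K = M" if "K \<in> S" "M \<subseteq> K" for K using that by simp
  have "maximalideal M R"
  proof (rule maximalidealI)
    show "ideal M R" "carrier R \<noteq> M" using MS by (auto simp: S_def)
    fix J assume J: "ideal J R" "M \<subseteq> J"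
    show "J = M \<or> J = carrier R"
    proof (cases "\<one> \<in> J")
      case True
      then show ?thesis using ideal.one_imp_carrier[OF J(1)] by simp
    next
      case False
      then have "J \<in> S" using MS J by (auto simp: S_def)
      then show ?thesis using max J(2) by blast
    qed
  qed
  then have "M = \<mm>" by (rule unique_maximal)
  then show ?thesis using MS by (auto simp: S_def)
qed

lemma one_notin: "\<one> \<notin> \<mm>"
  using one_imp_carrier I_notcarr by blast

text \<open>For \<open>x \<in> \<mm>\<close> the element \<open>\<one> \<ominus> x\<close> is a
  unit, and it kills \<open>y\<close>. This instance of Nakayama's lemma later forces
  \<open>a \<otimes> a = \<zero>\<close> in two contradictions.\<close>

lemma one_minus_cancel:
  assumes noeth: "noetherian_ring R" and x: "x \<in> \<mm>" and y: "y \<in> carrier R" "y \<otimes> x = y"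
  shows "y = \<zero>"
proof -
  have xc: "x \<in> carrier R" using x by simp
  have "\<one> \<in> PIdl (\<one> \<ominus> x)"
  proof (rule ccontr)
    assume "\<one> \<notin> PIdl (\<one> \<ominus> x)"
    then have "PIdl (\<one> \<ominus> x) \<subseteq> \<mm>"
      using proper_ideal_subset[OF noeth cgenideal_ideal] xc by simp
    then have "\<one> \<ominus> x \<in> \<mm>" using cgenideal_self[of "\<one> \<ominus> x"] xc by auto
    then have "(\<one> \<ominus> x) \<oplus> x \<in> \<mm>" using x by simp
    moreover have "(\<one> \<ominus> x) \<oplus> x = \<one>" using xc by (simp add: a_minus_def a_assoc l_neg)
    ultimately show False using one_notin by simp
  qed
  then obtain u where u: "u \<in> carrier R" "\<one> = u \<otimes> (\<one> \<ominus> x)" by (auto simp: cgenideal_def)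
  have "y = y \<otimes> (u \<otimes> (\<one> \<ominus> x))" using y(1) u(2)[symmetric] by simp
  also have "\<dots> = u \<otimes> (y \<ominus> y \<otimes> x)"
    using y(1) u(1) xc by (simp add: m_ac r_distr a_minus_def r_minus)
  also have "\<dots> = \<zero>" using y u(1) by (simp add: a_minus_def r_neg)
  finally show ?thesis .
qed

text \<open>A nilpotent \<open>a\<close> lies in every prime, so every prime contains the radical
  \<open>\<mm>\<close> of \<open>(a)\<close>. Then \<open>\<mm>\<close> is the only prime and the
  dimension is 0.\<close>

lemma parameter_not_nilpotent:
  assumes dim: "krull_dim R = 1" and rad: "radical R (PIdl a) = \<mm>" and a: "a \<in> carrier R"
  shows "a [^] (n::nat) \<noteq> \<zero>"
proof
  assume nil: "a [^] n = \<zero>"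
  have prime: "P = \<mm>" if "primeideal P R" for P
  proof -
    interpret P: primeideal P R by fact
    have pow: "y \<in> P" if "y \<in> carrier R" "y [^] (k::nat) \<in> P" for y k
      using that
    proof (induction k)
      case 0
      then show ?case using P.one_imp_carrier P.I_notcarr by simp
    next
      case (Suc k)
      then show ?case using P.I_prime[of "y [^] k" y] by auto
    qed
    have "a \<in> P" using pow[of a n] a nil by simp
    then have "PIdl a \<subseteq> P" by (rule cgenideal_minimal[OF P.is_ideal])
    then have "\<mm> \<subseteq> P" using rad pow by (auto simp: radical_def)
    then show ?thesis using I_maximal[OF P.is_ideal] P.I_notcarr ideal_subset[OF P.is_ideal] by auto
  qed
  have "n = 0" if "\<forall>i\<le>n. primeideal (P i) R" "\<forall>i<n. P i \<subset> P (Suc i)" for n and P :: "nat \<Rightarrow> 'a set"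
  proof (rule ccontr)
    assume "n \<noteq> 0"
    then have "P 0 \<subset> P 1" "P 0 = \<mm>" "P 1 = \<mm>" using that prime by auto
    then show False by simp
  qed
  then have "krull_dim R \<le> 0"
    unfolding krull_dim_def zero_enat_def by (auto intro!: Sup_least)
  with dim show False by simp
qed

text \<open>The assumption \<open>dual\<close> says that \<open>0 :\<^sub>R a\<close> is a faithful module over \<open>R/(a)\<close>.\<close>

lemma no_dual_parameter:
  assumes noeth: "noetherian_ring R" and am: "a \<in> \<mm>" and rad: "radical R (PIdl a) = \<mm>"
    and nil: "\<And>n::nat. a [^] n \<noteq> \<zero>"
    and coh: "\<And>y x. y \<in> ideal_prod R \<mm> \<mm> \<Longrightarrow> x \<in> local_cohomology_0 R \<mm> \<Longrightarrow> y \<otimes> x = \<zero>"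
    and emb: "ideal_length R \<mm> (ideal_prod R \<mm> \<mm>) \<le> 4"
    and dual: "annihilator R (annihilator R {a}) \<subseteq> PIdl a"
  shows False
proof -
  have m: "ideal \<mm> R" and max: "maximalideal \<mm> R" by (fact is_ideal) (fact is_maximalideal)
  have a: "a \<in> carrier R" using am by simp
  define m2 where "m2 = ideal_prod R \<mm> \<mm>"
  \<comment> \<open>The annihilator of \<open>\<mm>^2\<close> serves as the zeroth local cohomology:
    it contains the latter by \<open>coh\<close>, and an element killed by \<open>\<mm>^2\<close>
    belongs to the latter by definition. In this form it is visibly an ideal.\<close>
  define H where "H = annihilator R m2"
  define I where "I = annihilator R {a}"
  define mI where "mI = ideal_prod R \<mm> I"
  have m2: "ideal m2 R" unfolding m2_def by (rule ideal_prod_is_ideal[OF m m])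
  have m2m: "m2 \<subseteq> \<mm>" using ideal_prod_inter[OF m m] by (simp add: m2_def)
  have m2I: "x \<otimes> y \<in> m2" if "x \<in> \<mm>" "y \<in> \<mm>" for x y
    unfolding m2_def using that by (rule ideal_prod.prod)
  have Pa: "ideal (PIdl a) R" using cgenideal_ideal[OF a] .
  have Pam: "PIdl a \<subseteq> \<mm>" by (rule cgenideal_minimal[OF m am])
  have H: "ideal H R" unfolding H_def by (rule annihilator_ideal[OF ideal_subset[OF m2]])
  have I: "ideal I R" unfolding I_def using annihilator_ideal a by simp
  have mI: "ideal mI R" unfolding mI_def by (rule ideal_prod_is_ideal[OF m I])
  have Hc: "H \<subseteq> carrier R" and Ic: "I \<subseteq> carrier R" using ideal_subset H I by auto
  have Hm2: "h \<otimes> y = \<zero>" if "h \<in> H" "y \<in> m2" for h y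
    using that by (simp add: H_def annihilator_def)
  have cohH: "x \<in> H" if "x \<in> local_cohomology_0 R \<mm>" for x
  proof -
    have xc: "x \<in> carrier R" using that by (simp add: local_cohomology_0_def)
    have "x \<otimes> y = \<zero>" if "y \<in> m2" for y
      using coh[of y x] that \<open>x \<in> local_cohomology_0 R \<mm>\<close> xc m_comm[of x y] ideal.Icarr[OF m2 that]
      by (simp add: m2_def)
    then show ?thesis using xc by (simp add: H_def annihilator_def)
  qed
  obtain s where s: "ideal_power R \<mm> s \<subseteq> PIdl a"
  proof (rule ideal_power_subset[OF noeth m Pa])
    fix y assume "y \<in> \<mm>"
    then show "\<exists>n::nat. y [^] n \<in> PIdl a" unfolding rad[symmetric] by (simp add: radical_def)
  qed
  \<comment> \<open>If \<open>x \<otimes> a\<close> is killed by \<open>\<mm>^2\<close>, then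
    \<open>x\<close> is killed by \<open>\<mm>^2 (a)\<close>, which contains
    \<open>\<mm>^(2 + s)\<close>. So \<open>x\<close> lies in the local cohomology.\<close>
  have regH: "x \<in> H" if x: "x \<in> carrier R" "x \<otimes> a \<in> H" for x
  proof (rule cohH)
    have "y \<otimes> x = \<zero>" if y: "y \<in> ideal_power R \<mm> (2 + s)" for y
    proof -
      have ann: "ideal (annihilator R {x}) R" using x(1) annihilator_ideal by simp
      have "ideal_prod R m2 (ideal_power R \<mm> s) \<subseteq> annihilator R {x}"
      proof (rule ideal_prod_subset[OF ann])
        fix u v assume u: "u \<in> m2" and "v \<in> ideal_power R \<mm> s"
        then obtain r where r: "r \<in> carrier R" "v = r \<otimes> a" using s by (auto simp: cgenideal_def)
        have uc: "u \<in> carrier R" using ideal.Icarr[OF m2 u] .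
        have "(u \<otimes> v) \<otimes> x = r \<otimes> ((x \<otimes> a) \<otimes> u)"
          unfolding r(2) using r(1) uc x(1) a by (simp add: m_ac)
        also have "\<dots> = \<zero>" using Hm2[OF x(2) u] r(1) by simp
        finally show "u \<otimes> v \<in> annihilator R {x}" using uc r a by (simp add: annihilator_def)
      qed
      then show ?thesis
        using y unfolding ideal_power_add[OF m] ideal_power_2[OF m] m2_def
        by (auto simp: annihilator_def)
    qed
    then show "x \<in> local_cohomology_0 R \<mm>"
      unfolding local_cohomology_0_def using x(1) by (auto intro!: exI[of _ "2 + s"])
  qed
  have IH: "I \<subseteq> H"
    using regH ideal_zero[OF H] by (auto simp: I_def annihilator_def)
  \<comment> \<open>Since \<open>I \<subseteq> H\<close>, all of \<open>\<mm>^2\<close> kills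
    \<open>I\<close>, and \<open>dual\<close> puts it into \<open>(a)\<close>.\<close>
  have m2a: "m2 \<subseteq> PIdl a"
  proof -
    have "y \<in> annihilator R I" if y: "y \<in> m2" for y
    proof -
      have "y \<otimes> x = \<zero>" if "x \<in> I" for x
        using Hm2[OF subsetD[OF IH that] y] m_comm[OF ideal.Icarr[OF m2 y] subsetD[OF Ic that]]
        by simp
      then show ?thesis using ideal.Icarr[OF m2 y] by (simp add: annihilator_def)
    qed
    then show ?thesis using dual by (auto simp: I_def)
  qed
  have annI: "\<mm> \<inter> annihilator R I = PIdl a"
  proof
    show "\<mm> \<inter> annihilator R I \<subseteq> PIdl a" using dual by (auto simp: I_def)
    have "PIdl a \<subseteq> annihilator R I"
    proof (rule cgenideal_minimal[OF annihilator_ideal[OF Ic]])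
      have "a \<otimes> x = \<zero>" if "x \<in> I" for x
        using that a Ic m_comm[of a x] by (auto simp: I_def annihilator_def)
      then show "a \<in> annihilator R I" using a by (simp add: annihilator_def)
    qed
    then show "PIdl a \<subseteq> \<mm> \<inter> annihilator R I" using Pam by auto
  qed
  \<comment> \<open>In \<open>y (u v) = v (u y)\<close> the factor \<open>u \<otimes> y\<close> lies
    in \<open>\<mm>^2\<close> and \<open>v\<close> in \<open>H\<close>.\<close>
  have kill: "y \<otimes> z = \<zero>" if K: "K \<subseteq> H" "ideal K R" and y: "y \<in> \<mm>" and z: "z \<in> ideal_prod R \<mm> K" for K y z
  proof -
    have yc: "y \<in> carrier R" using y by simp
    have "ideal_prod R \<mm> K \<subseteq> annihilator R {y}"
    proof (rule ideal_prod_subset)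
      show "ideal (annihilator R {y}) R" using yc annihilator_ideal by simp
      fix u v assume uv: "u \<in> \<mm>" "v \<in> K"
      then have c: "u \<in> carrier R" "v \<in> carrier R" using K Hc by auto
      have "(u \<otimes> v) \<otimes> y = v \<otimes> (u \<otimes> y)" using c yc by (simp add: m_ac)
      also have "\<dots> = \<zero>" using Hm2[OF _ m2I] uv y K by auto
      finally show "u \<otimes> v \<in> annihilator R {y}" using c by (simp add: annihilator_def)
    qed
    then have "z \<in> carrier R" "z \<otimes> y = \<zero>" using z by (auto simp: annihilator_def)
    then show ?thesis using yc m_comm[of y z] by simp
  qed
  \<comment> \<open>Both factors of the filtration of \<open>K\<close> by \<open>\<mm>K\<close> and
    \<open>0\<close> are killed by \<open>\<mm>\<close>, hence of finite length.\<close>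
  have fin: "ideal_length R K {\<zero>} \<noteq> \<infinity>" if K: "K \<subseteq> H" "ideal K R" for K
  proof -
    have mK: "ideal (ideal_prod R \<mm> K) R" by (rule ideal_prod_is_ideal[OF m K(2)])
    have sub: "ideal_prod R \<mm> K \<subseteq> K" using ideal_prod_inter[OF m K(2)] by simp
    have zero: "{\<zero>} \<subseteq> ideal_prod R \<mm> K" using ideal_zero[OF mK] by simp
    have "ideal_length R K (ideal_prod R \<mm> K) \<noteq> \<infinity>"
      by (rule ideal_length_finite[OF noeth max K(2) mK sub]) (rule ideal_prod.prod)
    moreover have "ideal_length R (ideal_prod R \<mm> K) {\<zero>} \<noteq> \<infinity>"
      by (rule ideal_length_finite[OF noeth max mK zeroideal zero]) (use kill[OF K] in simp)
    ultimately show ?thesis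
      using ideal_length_additive[OF K(2) mK zeroideal zero sub] by auto
  qed
  have mII: "mI \<subseteq> I" unfolding mI_def using ideal_prod_inter[OF m I] by simp
  have mI0: "{\<zero>} \<subseteq> mI" using ideal_zero[OF mI] by simp
  have addI: "ideal_length R I {\<zero>} = ideal_length R I mI + ideal_length R mI {\<zero>}"
    by (rule ideal_length_additive[OF I mI zeroideal mI0 mII])
  obtain p q where p: "ideal_length R I mI = enat p" and q: "ideal_length R mI {\<zero>} = enat q"
    using addI fin[OF IH I]
    by (cases "ideal_length R I mI"; cases "ideal_length R mI {\<zero>}") auto
  \<comment> \<open>Besides bounding \<open>r\<close>, this equation shows below that the second
    summand vanishes when \<open>r = 4\<close>.\<close>
  have addm: "ideal_length R \<mm> m2 = ideal_length R \<mm> (PIdl a) + ideal_length R (PIdl a) m2"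
    by (rule ideal_length_additive[OF m Pa m2 m2a Pam])
  obtain r where r: "ideal_length R \<mm> (PIdl a) = enat r"
    using addm emb unfolding m2_def[symmetric]
    by (cases "ideal_length R \<mm> (PIdl a)") auto
  have r4: "r \<le> 4"
  proof -
    have "enat r \<le> ideal_length R \<mm> m2" unfolding addm r by (simp add: add_increasing2)
    also have "\<dots> \<le> 4" using emb by (simp add: m2_def)
    finally show ?thesis by (simp add: numeral_eq_enat)
  qed
  \<comment> \<open>All of \<open>\<mm>\<close> kills \<open>\<mm>I\<close>, while by
    \<open>annI\<close> the part of \<open>\<mm>\<close> that kills \<open>I\<close> is
    \<open>(a)\<close>. So the bound applies to \<open>\<mm>/(a)\<close> acting from
    \<open>I/\<mm>I\<close> to \<open>\<mm>I\<close>.\<close>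
  have rpq: "r \<le> p * q"
  proof -
    have "\<mm> \<inter> annihilator R mI = \<mm>"
      using kill[OF IH I] by (auto simp: mI_def annihilator_def)
    moreover have "ideal_length R (\<mm> \<inter> annihilator R mI) (\<mm> \<inter> annihilator R I)
        \<le> enat p * ideal_length R mI {\<zero>}"
      by (rule ideal_length_annihilators[OF m I mI mI mII _ p]) (simp add: mI_def ideal_prod.prod)
    ultimately show ?thesis by (simp add: annI r q)
  qed
  define B where "B = H <+> PIdl a"
  have B: "ideal B R" unfolding B_def by (rule add_ideals[OF H Pa])
  have BH: "H \<subseteq> B" and Ba: "PIdl a \<subseteq> B" using subset_set_add[OF H Pa] by (auto simp: B_def)
  have Bc: "B \<subseteq> carrier R" by (rule ideal_subset[OF B])
  have a2: "a \<otimes> a \<in> m2" using m2I[OF am am] .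
  have a20: "a \<otimes> a \<noteq> \<zero>" using nil[of 2] a by (simp add: numeral_2_eq_2)
  \<comment> \<open>From \<open>1 = h + t a\<close> and \<open>h a^2 = 0\<close> follows
    \<open>a^2 = a^2 (t a)\<close> with \<open>t a \<in> \<mm>\<close>, which forces
    \<open>a^2 = 0\<close>.\<close>
  have oneB: "\<one> \<notin> B"
  proof
    assume "\<one> \<in> B"
    then obtain h t where h: "h \<in> H" "t \<in> carrier R" "\<one> = h \<oplus> t \<otimes> a"
      unfolding B_def mem_add_PIdl by blast
    have hc: "h \<in> carrier R" using h(1) Hc by auto
    have "(a \<otimes> a) \<otimes> (t \<otimes> a) = h \<otimes> (a \<otimes> a) \<oplus> (a \<otimes> a) \<otimes> (t \<otimes> a)"
      using Hm2[OF h(1) a2] a h(2) by simp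
    also have "\<dots> = (a \<otimes> a) \<otimes> (h \<oplus> t \<otimes> a)"
      using hc h(2) a by (simp add: r_distr m_comm)
    also have "\<dots> = a \<otimes> a" using h(3)[symmetric] a by simp
    finally have "a \<otimes> a = \<zero>"
      using one_minus_cancel[OF noeth, of "t \<otimes> a" "a \<otimes> a"] I_l_closed[OF am h(2)] a by simp
    then show False using a20 by simp
  qed
  have Bm: "B \<subseteq> \<mm>" by (rule proper_ideal_subset[OF noeth B oneB])
  have mc: "\<mm> \<subset> carrier R" using ideal_subset[OF m] I_notcarr by auto
  have addR: "ideal_length R (carrier R) (PIdl a) = ideal_length R (carrier R) \<mm> + enat r"
    using ideal_length_additive[OF oneideal m Pa Pam] mc by (simp add: r)
  have resid: "ideal_length R (carrier R) \<mm> \<le> 1"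
  proof -
    have "\<mm> <+> PIdl \<one> = carrier R"
      using ideal.one_imp_carrier[OF subset_add_PIdl(1)[OF m one_closed]]
        subset_add_PIdl(3)[OF m one_closed] .
    then show ?thesis
      using ideal_length_cyclic[OF max m one_closed] Icarr by simp
  qed
  have snake: "ideal_length R (carrier R) B + (enat p + enat q) \<le> 1 + enat r"
  proof -
    have "ideal_length R (carrier R) B + ideal_length R I {\<zero>} \<le> ideal_length R (carrier R) (PIdl a)"
      unfolding B_def I_def by (rule ideal_length_snake[OF H a fin[OF order_refl H] regH])
    also have "\<dots> \<le> 1 + enat r" unfolding addR using resid by (rule add_right_mono)
    finally show ?thesis by (simp add: addI p q)
  qed
  obtain t where t: "ideal_length R (carrier R) B = enat t"
    using snake by (cases "ideal_length R (carrier R) B") (auto simp: one_enat_def)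
  have t1: "1 \<le> t"
    using one_le_ideal_length[OF oneideal, of B] Bm mc t by (auto simp: one_enat_def)
  have t2: "2 \<le> t" if "r = 4"
  proof -
    have "m2 = PIdl a"
    proof (rule ccontr)
      assume "m2 \<noteq> PIdl a"
      then have "1 \<le> ideal_length R (PIdl a) m2" using one_le_ideal_length[OF Pa] m2a by auto
      then have "enat r + 1 \<le> ideal_length R \<mm> m2" unfolding addm r by (rule add_left_mono)
      also have "\<dots> \<le> 4" using emb by (simp add: m2_def)
      finally show False using that by (simp add: numeral_eq_enat one_enat_def)
    qed
    \<comment> \<open>Because \<open>a\<close> lies in \<open>\<mm>^2\<close>, it kills
      \<open>H\<close>.\<close>
    then have am2: "a \<in> m2" using cgenideal_self[OF a] by simp
    have "B \<noteq> \<mm>"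
    proof
      assume Bm: "B = \<mm>"
      \<comment> \<open>For \<open>x = h + u a\<close> and \<open>y = k + v a\<close> with
        \<open>h\<close>, \<open>k\<close> killed by \<open>a\<close>, the product
        \<open>x y a\<close> equals \<open>u v a^3\<close>. This yields
        \<open>\<mm>^2 a \<subseteq> (a^3)\<close>.\<close>
      define c where "c = a \<otimes> a \<otimes> a"
      have cc: "c \<in> carrier R" using a by (simp add: c_def)
      have "m2 \<subseteq> {z \<in> carrier R. z \<otimes> a \<in> PIdl c}"
        unfolding m2_def
      proof (rule ideal_prod_subset[OF ideal_colon[OF cgenideal_ideal[OF cc] a]])
        fix x y assume xy: "x \<in> \<mm>" "y \<in> \<mm>"
        obtain h u where h: "h \<in> H" "u \<in> carrier R" "x = h \<oplus> u \<otimes> a"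
          using xy Bm unfolding B_def[symmetric] by (metis B_def mem_add_PIdl)
        obtain k v where k: "k \<in> H" "v \<in> carrier R" "y = k \<oplus> v \<otimes> a"
          using xy Bm unfolding B_def[symmetric] by (metis B_def mem_add_PIdl)
        have hk: "h \<in> carrier R" "k \<in> carrier R" "h \<otimes> a = \<zero>" "k \<otimes> a = \<zero>"
          using h k Hc Hm2[OF _ am2] by auto
        have "(x \<otimes> y) \<otimes> a = x \<otimes> (k \<otimes> a \<oplus> v \<otimes> a \<otimes> a)"
          using hk k h a unfolding k(3) by (simp add: h(3) m_assoc l_distr)
        also have "\<dots> = (h \<otimes> a) \<otimes> (v \<otimes> a) \<oplus> (u \<otimes> v) \<otimes> c"
          using hk(1,2) k(2) h(2) a unfolding hk(4) h(3) c_def by (simp add: l_distr r_distr m_ac)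
        also have "\<dots> = (u \<otimes> v) \<otimes> c" using hk k h a cc by simp
        finally have "(x \<otimes> y) \<otimes> a \<in> PIdl c" using h(2) k(2) by (auto simp: cgenideal_def)
        then show "x \<otimes> y \<in> {z \<in> carrier R. z \<otimes> a \<in> PIdl c}" using xy by simp
      qed
      \<comment> \<open>The inclusion is applied to \<open>a\<close> itself, an element of
        \<open>\<mm>^2\<close>, so \<open>a^2\<close> is a multiple of \<open>a^3\<close>.\<close>
      then obtain w where w: "w \<in> carrier R" "a \<otimes> a = w \<otimes> c"
        using am2 by (auto simp: cgenideal_def)
      have "(a \<otimes> a) \<otimes> (w \<otimes> a) = w \<otimes> c"
        using w(1) a by (simp add: c_def m_ac)
      then have "(a \<otimes> a) \<otimes> (w \<otimes> a) = a \<otimes> a" using w(2) by simp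
      then have "a \<otimes> a = \<zero>"
        using one_minus_cancel[OF noeth, of "w \<otimes> a" "a \<otimes> a"] I_l_closed[OF am w(1)] a by simp
      then show False using a20 by simp
    qed
    then have "B \<subset> \<mm>" using Bm by auto
    then have "ideal_chain R 2 (carrier R) B"
      using m mc oneideal by (auto simp: numeral_2_eq_2)
    then show ?thesis using le_ideal_length[of R 2 "carrier R" B] t by simp
  qed
  have "t + p + q \<le> 1 + r"
    using snake unfolding t one_enat_def by simp
  from length_arithmetic[OF this rpq r4 t1 t2] have "p = 0" "q = 0" by auto
  then have "ideal_length R I {\<zero>} = 0" by (simp add: addI p q zero_enat_def)
  then have "\<not> {\<zero>} \<subset> I" using one_le_ideal_length[OF I, of "{\<zero>}"] by auto
  then have "I = {\<zero>}" using ideal_zero[OF I] by auto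
  \<comment> \<open>The zero ideal is killed by \<open>\<one>\<close>, which \<open>dual\<close>
    would then put into \<open>(a) \<subseteq> \<mm>\<close>.\<close>
  then have "\<one> \<in> annihilator R I" by (simp add: annihilator_def)
  then show False using dual Pam one_notin by (auto simp: I_def)
qed

end

section \<open>Modules and free resolutions\<close>

lemma make_module_simps [simp]:
  "carrier (make_module C z p s) = C"
  "ring.zero (make_module C z p s) = z"
  "ring.add (make_module C z p s) = p"
  "smult (make_module C z p s) = s"
  by (simp_all add: make_module_def)

lemma (in cring) regular_module_simps [simp]:
  "carrier (regular_module R) = carrier R"
  "\<zero>\<^bsub>regular_module R\<^esub> = \<zero>"
  "x \<oplus>\<^bsub>regular_module R\<^esub> y = x \<oplus> y"
  "x \<odot>\<^bsub>regular_module R\<^esub> y = x \<otimes> y"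
  by (simp_all add: regular_module_def)

lemma (in cring) module_regular: "module R (regular_module R)"
proof (rule moduleI)
  show "abelian_group (regular_module R)"
    by (rule abelian_groupI) (auto simp: a_ac intro: bexI[of _ "\<ominus> _"] l_neg)
qed (auto simp: is_cring l_distr r_distr m_assoc)

lemma (in cring) module_free: "module R (free_module R S)"
proof -
  have add: "finite {x. f x \<oplus> g x \<noteq> \<zero>} \<and> {x. f x \<oplus> g x \<noteq> \<zero>} \<subseteq> S"
    if "finite {x. f x \<noteq> \<zero>}" "{x. f x \<noteq> \<zero>} \<subseteq> S" "finite {x. g x \<noteq> \<zero>}" "{x. g x \<noteq> \<zero>} \<subseteq> S"
    for f g :: "'c \<Rightarrow> 'a"
  proof -
    have "{x. f x \<oplus> g x \<noteq> \<zero>} \<subseteq> {x. f x \<noteq> \<zero>} \<union> {x. g x \<noteq> \<zero>}" by auto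
    then show ?thesis using that by (meson finite_Un finite_subset le_sup_iff subset_trans Un_least)
  qed
  have smult: "finite {x. r \<otimes> f x \<noteq> \<zero>} \<and> {x. r \<otimes> f x \<noteq> \<zero>} \<subseteq> S"
    if "finite {x. f x \<noteq> \<zero>}" "{x. f x \<noteq> \<zero>} \<subseteq> S" "r \<in> carrier R" for f :: "'c \<Rightarrow> 'a" and r
  proof -
    have "{x. r \<otimes> f x \<noteq> \<zero>} \<subseteq> {x. f x \<noteq> \<zero>}" using that by auto
    then show ?thesis using that by (meson finite_subset subset_trans)
  qed
  have neg: "{x. \<ominus> f x \<noteq> \<zero>} = {x. f x \<noteq> \<zero>}" if "range f \<subseteq> carrier R" for f :: "'c \<Rightarrow> 'a"
  proof -
    have "\<ominus> f x = \<zero> \<longleftrightarrow> f x = \<zero>" for x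
      using that by (metis add.inv_eq_1_iff rangeI subsetD)
    then show ?thesis by simp
  qed
  have carr: "f x \<in> carrier R" if "range f \<subseteq> carrier R" for f :: "'c \<Rightarrow> 'a" and x
    using that by auto
  show ?thesis
  proof (rule moduleI)
    show "abelian_group (free_module R S)"
    proof (rule abelian_groupI)
      fix f assume "f \<in> carrier (free_module R S)"
      then have f: "range f \<subseteq> carrier R" "finite {x. f x \<noteq> \<zero>}" "{x. f x \<noteq> \<zero>} \<subseteq> S"
        by (simp_all add: free_module_def)
      show "\<exists>g\<in>carrier (free_module R S). g \<oplus>\<^bsub>free_module R S\<^esub> f = \<zero>\<^bsub>free_module R S\<^esub>"
        using f carr[OF f(1)]
        by (intro bexI[of _ "\<lambda>x. \<ominus> f x"]) (auto simp: free_module_def neg l_neg)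
      show "\<zero>\<^bsub>free_module R S\<^esub> \<oplus>\<^bsub>free_module R S\<^esub> f = f"
        using carr[OF f(1)] by (simp add: free_module_def)
      fix g assume "g \<in> carrier (free_module R S)"
      then have g: "range g \<subseteq> carrier R" "finite {x. g x \<noteq> \<zero>}" "{x. g x \<noteq> \<zero>} \<subseteq> S"
        by (simp_all add: free_module_def)
      show "f \<oplus>\<^bsub>free_module R S\<^esub> g \<in> carrier (free_module R S)"
        using add[OF f(2,3) g(2,3)] carr[OF f(1)] carr[OF g(1)] by (auto simp: free_module_def)
      show "f \<oplus>\<^bsub>free_module R S\<^esub> g = g \<oplus>\<^bsub>free_module R S\<^esub> f"
        using carr[OF f(1)] carr[OF g(1)] by (simp add: free_module_def a_comm)
      fix h assume "h \<in> carrier (free_module R S)"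
      then have "range h \<subseteq> carrier R" by (simp add: free_module_def)
      from carr[OF this] show "f \<oplus>\<^bsub>free_module R S\<^esub> g \<oplus>\<^bsub>free_module R S\<^esub> h =
          f \<oplus>\<^bsub>free_module R S\<^esub> (g \<oplus>\<^bsub>free_module R S\<^esub> h)"
        using carr[OF f(1)] carr[OF g(1)] by (simp add: free_module_def a_assoc)
    qed (simp add: free_module_def image_subset_iff)
    fix r f assume r: "r \<in> carrier R" and "f \<in> carrier (free_module R S)"
    then have f: "range f \<subseteq> carrier R" "finite {x. f x \<noteq> \<zero>}" "{x. f x \<noteq> \<zero>} \<subseteq> S"
      by (simp_all add: free_module_def)
    show "r \<odot>\<^bsub>free_module R S\<^esub> f \<in> carrier (free_module R S)"
      using smult[OF f(2,3) r] carr[OF f(1)] r by (auto simp: free_module_def)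
  qed (auto simp: free_module_def is_cring l_distr r_distr m_assoc carr)
qed

lemma mem_a_r_coset: "y \<in> N +>\<^bsub>M\<^esub> x \<longleftrightarrow> (\<exists>n\<in>N. y = n \<oplus>\<^bsub>M\<^esub> x)"
  by (auto simp: a_r_coset_def')

lemma (in module) module_quotient:
  assumes "submodule N R M"
  shows "module R (quotient_module M N)"
    and "carrier (quotient_module M N) = (\<lambda>x. N +>\<^bsub>M\<^esub> x) ` carrier M"
    and "\<zero>\<^bsub>quotient_module M N\<^esub> = N"
    and "\<And>x y. x \<in> carrier M \<Longrightarrow> y \<in> carrier M \<Longrightarrow>
      (N +>\<^bsub>M\<^esub> x) \<oplus>\<^bsub>quotient_module M N\<^esub> (N +>\<^bsub>M\<^esub> y) = N +>\<^bsub>M\<^esub> (x \<oplus>\<^bsub>M\<^esub> y)"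
    and "\<And>r x. r \<in> carrier R \<Longrightarrow> x \<in> carrier M \<Longrightarrow>
      r \<odot>\<^bsub>quotient_module M N\<^esub> (N +>\<^bsub>M\<^esub> x) = N +>\<^bsub>M\<^esub> (r \<odot>\<^bsub>M\<^esub> x)"
proof -
  interpret N: abelian_subgroup N M
    using abelian_subgroupI3[OF additive_subgroupI M.abelian_group_axioms] submodule.axioms(1)[OF assms] .
  let ?Q = "quotient_module M N"
  show carr: "carrier ?Q = (\<lambda>x. N +>\<^bsub>M\<^esub> x) ` carrier M"
    by (auto simp: quotient_module_def A_RCOSETS_def RCOSETS_def a_r_coset_def)
  show zero: "\<zero>\<^bsub>?Q\<^esub> = N" by (simp add: quotient_module_def)
  show add: "(N +>\<^bsub>M\<^esub> x) \<oplus>\<^bsub>?Q\<^esub> (N +>\<^bsub>M\<^esub> y) = N +>\<^bsub>M\<^esub> (x \<oplus>\<^bsub>M\<^esub> y)"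
    if "x \<in> carrier M" "y \<in> carrier M" for x y
    using N.a_rcos_sum[OF that] by (simp add: quotient_module_def)
  show smult: "r \<odot>\<^bsub>?Q\<^esub> (N +>\<^bsub>M\<^esub> x) = N +>\<^bsub>M\<^esub> (r \<odot>\<^bsub>M\<^esub> x)"
    if r: "r \<in> carrier R" and x: "x \<in> carrier M" for r x
  proof -
    \<comment> \<open>Scalar multiplication on the quotient is a union over all representatives.
      Each of them yields the same coset, so the union collapses to it.\<close>
    have const: "N +>\<^bsub>M\<^esub> (r \<odot>\<^bsub>M\<^esub> y) = N +>\<^bsub>M\<^esub> (r \<odot>\<^bsub>M\<^esub> x)" if y: "y \<in> N +>\<^bsub>M\<^esub> x" for y
    proof -
      obtain n where n: "n \<in> N" "y = n \<oplus>\<^bsub>M\<^esub> x" using y unfolding mem_a_r_coset by blast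
      have "r \<odot>\<^bsub>M\<^esub> y = r \<odot>\<^bsub>M\<^esub> n \<oplus>\<^bsub>M\<^esub> r \<odot>\<^bsub>M\<^esub> x"
        using n r x N.a_Hcarr by (simp add: smult_r_distr)
      then have "r \<odot>\<^bsub>M\<^esub> y \<in> N +>\<^bsub>M\<^esub> (r \<odot>\<^bsub>M\<^esub> x)"
        unfolding mem_a_r_coset by (rule bexI[OF _ submodule.smult_closed[OF assms r n(1)]])
      then show ?thesis
        by (rule N.a_repr_independence'[symmetric]) (use r x in simp)
    qed
    have "N +>\<^bsub>M\<^esub> x \<noteq> {}" using N.a_rcos_self[OF x] by auto
    then have "(\<Union>y\<in>N +>\<^bsub>M\<^esub> x. N +>\<^bsub>M\<^esub> (r \<odot>\<^bsub>M\<^esub> y)) = N +>\<^bsub>M\<^esub> (r \<odot>\<^bsub>M\<^esub> x)"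
      by (rule SUP_eq_const) (rule const)
    then show ?thesis by (simp only: quotient_module_def make_module_simps)
  qed
  show "module R ?Q"
  proof (rule moduleI)
    have z: "N = N +>\<^bsub>M\<^esub> \<zero>\<^bsub>M\<^esub>" using M.a_coset_add_zero[OF N.a_subset] by simp
    show "abelian_group ?Q"
    proof (rule abelian_groupI)
      show "\<zero>\<^bsub>?Q\<^esub> \<in> carrier ?Q"
        unfolding zero carr by (rule image_eqI[where x = "\<zero>\<^bsub>M\<^esub>"]) (use z in auto)
      fix u assume "u \<in> carrier ?Q"
      then obtain x where x: "x \<in> carrier M" "u = N +>\<^bsub>M\<^esub> x" by (auto simp: carr)
      show "\<zero>\<^bsub>?Q\<^esub> \<oplus>\<^bsub>?Q\<^esub> u = u"
        unfolding zero x(2) using add[OF M.zero_closed x(1)] x(1) z[symmetric] by simp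
      show "\<exists>v\<in>carrier ?Q. v \<oplus>\<^bsub>?Q\<^esub> u = \<zero>\<^bsub>?Q\<^esub>"
        using x add[of "\<ominus>\<^bsub>M\<^esub> x" x] z[symmetric]
        by (intro bexI[of _ "N +>\<^bsub>M\<^esub> (\<ominus>\<^bsub>M\<^esub> x)"]) (auto simp: carr zero M.l_neg)
      fix v assume "v \<in> carrier ?Q"
      then obtain y where y: "y \<in> carrier M" "v = N +>\<^bsub>M\<^esub> y" by (auto simp: carr)
      show "u \<oplus>\<^bsub>?Q\<^esub> v \<in> carrier ?Q" "u \<oplus>\<^bsub>?Q\<^esub> v = v \<oplus>\<^bsub>?Q\<^esub> u"
        using x y by (auto simp: add carr M.a_comm)
      fix w assume "w \<in> carrier ?Q"
      then obtain t where "t \<in> carrier M" "w = N +>\<^bsub>M\<^esub> t" by (auto simp: carr)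
      with x y show "u \<oplus>\<^bsub>?Q\<^esub> v \<oplus>\<^bsub>?Q\<^esub> w = u \<oplus>\<^bsub>?Q\<^esub> (v \<oplus>\<^bsub>?Q\<^esub> w)"
        by (simp add: add M.a_assoc)
    qed
  qed (auto simp: carr add smult R.is_cring smult_l_distr smult_r_distr smult_assoc1)
qed

lemma (in module) linear_finsum:
  assumes N: "module R N" and h: "h \<in> carrier M \<rightarrow> carrier N"
    and add: "\<And>x y. x \<in> carrier M \<Longrightarrow> y \<in> carrier M \<Longrightarrow> h (x \<oplus>\<^bsub>M\<^esub> y) = h x \<oplus>\<^bsub>N\<^esub> h y"
    and zero: "h \<zero>\<^bsub>M\<^esub> = \<zero>\<^bsub>N\<^esub>"
    and "finite A" "f \<in> A \<rightarrow> carrier M"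
  shows "h (finsum M f A) = finsum N (\<lambda>x. h (f x)) A"
proof -
  interpret N: module R N by fact
  show ?thesis
    using assms(5,6)
  proof (induction A)
    case (insert x A)
    have "finsum M f (insert x A) = f x \<oplus>\<^bsub>M\<^esub> finsum M f A"
      by (rule M.finsum_insert) (use insert in auto)
    moreover have "finsum N (\<lambda>x. h (f x)) (insert x A) = h (f x) \<oplus>\<^bsub>N\<^esub> finsum N (\<lambda>x. h (f x)) A"
      by (rule N.M.finsum_insert) (use insert h in auto)
    moreover have "finsum M f A \<in> carrier M" by (rule M.finsum_closed) (use insert in auto)
    ultimately show ?case using insert add by auto
  qed (simp add: zero)
qed

text \<open>The linear map out of a free module that sends the basis element at \<open>x\<close> to
  \<open>g x\<close>. The identity gives \<open>cover_map\<close>, and a choice of representatives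
  will give a lift of it.\<close>

definition linear_extension ::
    "('a, 'b) ring_scheme \<Rightarrow> ('a, 'm, 'c) module_scheme \<Rightarrow> ('x \<Rightarrow> 'm) \<Rightarrow> ('x \<Rightarrow> 'a) \<Rightarrow> 'm" where
  "linear_extension R M g f = (\<Oplus>\<^bsub>M\<^esub>x \<in> {x. f x \<noteq> \<zero>\<^bsub>R\<^esub>}. f x \<odot>\<^bsub>M\<^esub> g x)"

lemma cover_map_eq: "cover_map R M = linear_extension R M (\<lambda>x. x)"
  by (rule ext) (simp add: cover_map_def linear_extension_def)

lemma free_moduleD:
  assumes "f \<in> carrier (free_module R S)"
  shows "f x \<in> carrier R" "finite {x. f x \<noteq> \<zero>\<^bsub>R\<^esub>}" "{x. f x \<noteq> \<zero>\<^bsub>R\<^esub>} \<subseteq> S"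
  using assms by (auto simp: free_module_def)

section \<open>Linear maps out of free modules, kernels and syzygies\<close>

context module
begin

text \<open>A larger finite index set adds only zero terms, so functions with different supports can
  be summed over a common set.\<close>

lemma linear_extension_superset:
  assumes f: "f \<in> carrier (free_module R S)" and g: "g \<in> S \<rightarrow> carrier M"
    and A: "finite A" "{x. f x \<noteq> \<zero>} \<subseteq> A" "A \<subseteq> S"
  shows "linear_extension R M g f = (\<Oplus>\<^bsub>M\<^esub>x \<in> A. f x \<odot>\<^bsub>M\<^esub> g x)"
  unfolding linear_extension_def
proof (rule M.add.finprod_mono_neutral_cong_left[OF A(1,2), unfolded monoid.simps partial_object.simps])
  show "f i \<odot>\<^bsub>M\<^esub> g i = \<zero>\<^bsub>M\<^esub>" if "i \<in> A - {x. f x \<noteq> \<zero>}" for i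
    using that g A(3) by (auto intro!: smult_l_null)
  show "(\<lambda>x. f x \<odot>\<^bsub>M\<^esub> g x) \<in> A \<rightarrow> carrier M"
    using free_moduleD(1)[OF f] g A(3) by auto
qed simp

lemma linear_extension_closed:
  assumes f: "f \<in> carrier (free_module R S)" and g: "g \<in> S \<rightarrow> carrier M"
  shows "linear_extension R M g f \<in> carrier M"
  unfolding linear_extension_def using free_moduleD[OF f] g
  by (intro M.finsum_closed) auto

lemma linear_extension_add:
  assumes f: "f \<in> carrier (free_module R S)" "f' \<in> carrier (free_module R S)"
    and g: "g \<in> S \<rightarrow> carrier M"
  shows "linear_extension R M g (f \<oplus>\<^bsub>free_module R S\<^esub> f') =
    linear_extension R M g f \<oplus>\<^bsub>M\<^esub> linear_extension R M g f'"
proof -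
  interpret F: module R "free_module R S" by (rule module_free)
  define A where "A = {x. f x \<noteq> \<zero>} \<union> {x. f' x \<noteq> \<zero>}"
  have A: "finite A" "{x. f x \<noteq> \<zero>} \<subseteq> A" "{x. f' x \<noteq> \<zero>} \<subseteq> A" "A \<subseteq> S"
    using free_moduleD[OF f(1)] free_moduleD[OF f(2)] by (auto simp: A_def)
  have sub: "{x. (f \<oplus>\<^bsub>free_module R S\<^esub> f') x \<noteq> \<zero>} \<subseteq> A"
    by (auto simp: A_def free_module_def)
  have "linear_extension R M g (f \<oplus>\<^bsub>free_module R S\<^esub> f') =
    (\<Oplus>\<^bsub>M\<^esub>x \<in> A. (f \<oplus>\<^bsub>free_module R S\<^esub> f') x \<odot>\<^bsub>M\<^esub> g x)"
    by (rule linear_extension_superset[OF F.M.a_closed[OF f] g A(1) sub A(4)])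
  also have "\<dots> = (\<Oplus>\<^bsub>M\<^esub>x \<in> A. f x \<odot>\<^bsub>M\<^esub> g x \<oplus>\<^bsub>M\<^esub> f' x \<odot>\<^bsub>M\<^esub> g x)"
    using free_moduleD(1)[OF f(1)] free_moduleD(1)[OF f(2)] g A(4)
    by (intro M.finsum_cong') (auto simp: free_module_def smult_l_distr subset_iff Pi_iff)
  also have "\<dots> = (\<Oplus>\<^bsub>M\<^esub>x \<in> A. f x \<odot>\<^bsub>M\<^esub> g x) \<oplus>\<^bsub>M\<^esub> (\<Oplus>\<^bsub>M\<^esub>x \<in> A. f' x \<odot>\<^bsub>M\<^esub> g x)"
    using free_moduleD(1)[OF f(1)] free_moduleD(1)[OF f(2)] g A(4)
    by (intro M.finsum_addf) (auto simp: subset_iff Pi_iff)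
  finally show ?thesis
    using linear_extension_superset[OF f(1) g A(1,2,4)] linear_extension_superset[OF f(2) g A(1,3,4)]
    by simp
qed

lemma linear_extension_smult:
  assumes r: "r \<in> carrier R" and f: "f \<in> carrier (free_module R S)" and g: "g \<in> S \<rightarrow> carrier M"
  shows "linear_extension R M g (r \<odot>\<^bsub>free_module R S\<^esub> f) = r \<odot>\<^bsub>M\<^esub> linear_extension R M g f"
proof -
  interpret F: module R "free_module R S" by (rule module_free)
  define A where "A = {x. f x \<noteq> \<zero>}"
  have A: "finite A" "{x. f x \<noteq> \<zero>} \<subseteq> A" "A \<subseteq> S"
    using free_moduleD[OF f] by (auto simp: A_def)
  have sub: "{x. (r \<odot>\<^bsub>free_module R S\<^esub> f) x \<noteq> \<zero>} \<subseteq> A"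
    using r by (auto simp: A_def free_module_def)
  have "linear_extension R M g (r \<odot>\<^bsub>free_module R S\<^esub> f) =
    (\<Oplus>\<^bsub>M\<^esub>x \<in> A. (r \<odot>\<^bsub>free_module R S\<^esub> f) x \<odot>\<^bsub>M\<^esub> g x)"
    by (rule linear_extension_superset[OF F.smult_closed[OF r f] g A(1) sub A(3)])
  also have "\<dots> = (\<Oplus>\<^bsub>M\<^esub>x \<in> A. r \<odot>\<^bsub>M\<^esub> (f x \<odot>\<^bsub>M\<^esub> g x))"
    using free_moduleD(1)[OF f] g A(3) r
    by (intro M.finsum_cong') (auto simp: free_module_def smult_assoc1 subset_iff Pi_iff)
  also have "\<dots> = r \<odot>\<^bsub>M\<^esub> (\<Oplus>\<^bsub>M\<^esub>x \<in> A. f x \<odot>\<^bsub>M\<^esub> g x)"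
    using free_moduleD(1)[OF f] g A r by (intro finsum_smult_ldistr[symmetric]) (auto simp: subset_iff Pi_iff)
  finally show ?thesis using linear_extension_superset[OF f g A] by simp
qed

lemma linear_extension_zero:
  "linear_extension R M g \<zero>\<^bsub>free_module R S\<^esub> = \<zero>\<^bsub>M\<^esub>"
  by (simp add: linear_extension_def free_module_def)

lemma linear_extension_single:
  assumes "s \<in> S" "r \<in> carrier R" "g \<in> S \<rightarrow> carrier M"
  shows "(\<lambda>x. if x = s then r else \<zero>) \<in> carrier (free_module R S)"
    and "linear_extension R M g (\<lambda>x. if x = s then r else \<zero>) = r \<odot>\<^bsub>M\<^esub> g s"
proof -
  have sub: "{x. (if x = s then r else \<zero>) \<noteq> \<zero>} \<subseteq> {s}" by auto
  then show f: "(\<lambda>x. if x = s then r else \<zero>) \<in> carrier (free_module R S)"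
    using assms finite_subset[OF sub] by (auto simp: free_module_def)
  show "linear_extension R M g (\<lambda>x. if x = s then r else \<zero>) = r \<odot>\<^bsub>M\<^esub> g s"
    using linear_extension_superset[OF f assms(3) _ sub] assms by (auto simp: Pi_iff)
qed

text \<open>A linear map out of a free module is determined on the basis. This serves to recognise
  the cover map of \<open>R/(a)\<close> as a lift to \<open>R\<close> followed by the
  projection.\<close>

lemma linear_extension_comp:
  assumes N: "module R N" and h: "h \<in> carrier M \<rightarrow> carrier N"
    and add: "\<And>x y. x \<in> carrier M \<Longrightarrow> y \<in> carrier M \<Longrightarrow> h (x \<oplus>\<^bsub>M\<^esub> y) = h x \<oplus>\<^bsub>N\<^esub> h y"
    and smult: "\<And>r x. r \<in> carrier R \<Longrightarrow> x \<in> carrier M \<Longrightarrow> h (r \<odot>\<^bsub>M\<^esub> x) = r \<odot>\<^bsub>N\<^esub> h x"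
    and f: "f \<in> carrier (free_module R S)" and g: "g \<in> S \<rightarrow> carrier M"
  shows "h (linear_extension R M g f) = linear_extension R N (\<lambda>x. h (g x)) f"
proof -
  interpret N: module R N by fact
  have hz: "h \<zero>\<^bsub>M\<^esub> \<in> carrier N" using h by auto
  have "h (\<zero> \<odot>\<^bsub>M\<^esub> \<zero>\<^bsub>M\<^esub>) = \<zero> \<odot>\<^bsub>N\<^esub> h \<zero>\<^bsub>M\<^esub>" by (rule smult) auto
  then have zero: "h \<zero>\<^bsub>M\<^esub> = \<zero>\<^bsub>N\<^esub>" using hz by simp
  have "h (linear_extension R M g f) =
      (\<Oplus>\<^bsub>N\<^esub>x \<in> {x. f x \<noteq> \<zero>}. h (f x \<odot>\<^bsub>M\<^esub> g x))"
    unfolding linear_extension_def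
    by (rule linear_finsum[OF N h add zero]) (use free_moduleD[OF f] g in auto)
  also have "\<dots> = linear_extension R N (\<lambda>x. h (g x)) f"
    unfolding linear_extension_def
    by (rule N.M.finsum_cong') (use free_moduleD[OF f] g h in \<open>auto simp: smult subset_iff Pi_iff\<close>)
  finally show ?thesis .
qed

lemma submodule_kernel:
  assumes N: "module R N" and h: "h \<in> carrier M \<rightarrow> carrier N"
    and add: "\<And>x y. x \<in> carrier M \<Longrightarrow> y \<in> carrier M \<Longrightarrow> h (x \<oplus>\<^bsub>M\<^esub> y) = h x \<oplus>\<^bsub>N\<^esub> h y"
    and smult: "\<And>r x. r \<in> carrier R \<Longrightarrow> x \<in> carrier M \<Longrightarrow> h (r \<odot>\<^bsub>M\<^esub> x) = r \<odot>\<^bsub>N\<^esub> h x"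
  shows "submodule (a_kernel M N h) R M"
proof -
  interpret N: module R N by fact
  have z: "h (\<zero> \<odot>\<^bsub>M\<^esub> x) = \<zero>\<^bsub>N\<^esub>" if "x \<in> carrier M" for x
    using smult[OF R.zero_closed that] h that by (auto simp: Pi_iff)
  show ?thesis
  proof (rule submoduleI)
    show "\<zero>\<^bsub>M\<^esub> \<in> a_kernel M N h"
      using z[of "\<zero>\<^bsub>M\<^esub>"] by (simp add: a_kernel_def')
    show "\<ominus>\<^bsub>M\<^esub> x \<in> a_kernel M N h" if "x \<in> a_kernel M N h" for x
    proof -
      have x: "x \<in> carrier M" "h x = \<zero>\<^bsub>N\<^esub>" using that by (auto simp: a_kernel_def')
      have "\<ominus>\<^bsub>M\<^esub> x = (\<ominus> \<one>) \<odot>\<^bsub>M\<^esub> x" using x by (simp add: smult_l_minus)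
      then have "h (\<ominus>\<^bsub>M\<^esub> x) = (\<ominus> \<one>) \<odot>\<^bsub>N\<^esub> \<zero>\<^bsub>N\<^esub>" using smult[of "\<ominus> \<one>" x] x by simp
      then show ?thesis using x by (simp add: a_kernel_def')
    qed
  qed (auto simp: a_kernel_def' add smult)
qed

lemma cover_map_closed: "f \<in> carrier (free_cover R M) \<Longrightarrow> cover_map R M f \<in> carrier M"
  unfolding cover_map_eq free_cover_def by (rule linear_extension_closed) auto

lemma cover_map_add:
  "f \<in> carrier (free_cover R M) \<Longrightarrow> f' \<in> carrier (free_cover R M) \<Longrightarrow>
    cover_map R M (f \<oplus>\<^bsub>free_cover R M\<^esub> f') = cover_map R M f \<oplus>\<^bsub>M\<^esub> cover_map R M f'"
  unfolding cover_map_eq free_cover_def by (rule linear_extension_add) auto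

lemma cover_map_smult:
  "r \<in> carrier R \<Longrightarrow> f \<in> carrier (free_cover R M) \<Longrightarrow>
    cover_map R M (r \<odot>\<^bsub>free_cover R M\<^esub> f) = r \<odot>\<^bsub>M\<^esub> cover_map R M f"
  unfolding cover_map_eq free_cover_def by (rule linear_extension_smult) auto

lemma module_syzygy: "module R (syzygy R M)"
proof -
  interpret F: module R "free_cover R M" unfolding free_cover_def by (rule module_free)
  have "submodule (a_kernel (free_cover R M) M (cover_map R M)) R (free_cover R M)"
    by (rule F.submodule_kernel[OF module_axioms])
      (auto simp: cover_map_closed cover_map_add cover_map_smult)
  then show ?thesis
    unfolding syzygy_def by (rule submodule.submodule_is_module) (rule F.module_axioms)
qed

lemma carrier_syzygy:
  "carrier (syzygy R M) = {f \<in> carrier (free_cover R M). cover_map R M f = \<zero>\<^bsub>M\<^esub>}"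
  by (simp add: syzygy_def a_kernel_def')

end

lemma syzygy_simps [simp]:
  "ring.zero (syzygy R M) = ring.zero (free_cover R M)"
  "ring.add (syzygy R M) = ring.add (free_cover R M)"
  "smult (syzygy R M) = smult (free_cover R M)"
  by (simp_all add: syzygy_def)

section \<open>Embedding dimension in terms of ideals\<close>

lemma (in cring) submodule_regular:
  assumes "ideal I R"
  shows "submodule I R (regular_module R)"
proof -
  interpret M: module R "regular_module R" by (rule module_regular)
  have neg: "\<ominus>\<^bsub>regular_module R\<^esub> x = \<ominus> x" for x
    by (simp add: a_inv_def m_inv_def regular_module_def)
  have "subgroup I (add_monoid R)"
    using assms by (simp add: additive_subgroup.a_subgroup ideal.axioms(1))
  then show ?thesis
    using ideal_subset[OF assms] ideal_zero[OF assms] ideal_add[OF assms] ideal.I_l_closed[OF assms]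
    by (intro M.submoduleI) (auto simp: neg subgroup.m_inv_closed[of I "add_monoid R", folded a_inv_def])
qed

text \<open>An ideal \<open>N\<close> between \<open>\<mm>^2\<close> and \<open>\<mm>\<close> yields
  the submodule \<open>N/\<mm>^2\<close>, and strict inclusions stay strict, so chains of ideals
  become chains of submodules.\<close>

lemma (in cring) ideal_length_le_embedding_dim:
  assumes m: "ideal \<mm> R"
  shows "ideal_length R \<mm> (ideal_prod R \<mm> \<mm>) \<le> embedding_dim R \<mm>"
proof -
  define m2 where "m2 = ideal_prod R \<mm> \<mm>"
  define M where "M = regular_module R\<lparr>carrier := \<mm>\<rparr>"
  have m2: "ideal m2 R" "m2 \<subseteq> \<mm>"
    using ideal_prod_is_ideal[OF m m] ideal_prod_inter[OF m m] by (auto simp: m2_def)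
  have M_simps: "carrier M = \<mm>" "\<zero>\<^bsub>M\<^esub> = \<zero>" "\<And>x y. x \<oplus>\<^bsub>M\<^esub> y = x \<oplus> y" "\<And>x y. x \<odot>\<^bsub>M\<^esub> y = x \<otimes> y"
    by (simp_all add: M_def regular_module_def)
  interpret M: module R M
    unfolding M_def by (rule submodule.submodule_is_module[OF submodule_regular[OF m] module_regular])
  have sub_m2: "submodule m2 R M"
  proof (rule M.submoduleI)
    show "\<ominus>\<^bsub>M\<^esub> x \<in> m2" if "x \<in> m2" for x
    proof -
      have "\<ominus>\<^bsub>M\<^esub> x = (\<ominus> \<one>) \<odot>\<^bsub>M\<^esub> x"
        using M.smult_l_minus[of \<one> x] that m2(2) by (simp add: M_simps(1) subset_iff)
      then show ?thesis using that ideal.I_l_closed[OF m2(1)] by (simp add: M_simps)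
    qed
  qed (use m2 ideal_zero[OF m2(1)] ideal_add[OF m2(1)] ideal.I_l_closed[OF m2(1)]
      in \<open>auto simp: M_simps\<close>)
  note Q = M.module_quotient[OF sub_m2]
  define Q where "Q = quotient_module M m2"
  interpret Q: module R Q unfolding Q_def by (rule Q(1))
  define coset where "coset x = m2 +>\<^bsub>M\<^esub> x" for x
  have Q_simps: "carrier Q = coset ` \<mm>" "\<zero>\<^bsub>Q\<^esub> = m2"
    "\<And>x y. x \<in> \<mm> \<Longrightarrow> y \<in> \<mm> \<Longrightarrow> coset x \<oplus>\<^bsub>Q\<^esub> coset y = coset (x \<oplus> y)"
    "\<And>r x. r \<in> carrier R \<Longrightarrow> x \<in> \<mm> \<Longrightarrow> r \<odot>\<^bsub>Q\<^esub> coset x = coset (r \<otimes> x)"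
    using Q(2-5) by (simp_all add: M_simps Q_def coset_def)
  have mc: "x \<in> carrier R" if "x \<in> \<mm>" for x using ideal.Icarr[OF m that] .
  have coset0: "coset \<zero> = m2"
    unfolding coset_def using M.a_coset_add_zero[of m2] m2(2) by (simp add: M_simps)
  have sub: "submodule (coset ` N) R Q" if N: "ideal N R" "N \<subseteq> \<mm>" for N
  proof (rule Q.submoduleI)
    show "coset ` N \<subseteq> carrier Q" using N by (auto simp: Q_simps)
    show "\<zero>\<^bsub>Q\<^esub> \<in> coset ` N" unfolding Q_simps(2) using coset0 ideal_zero[OF N(1)] by blast
    show add: "u \<oplus>\<^bsub>Q\<^esub> v \<in> coset ` N" if uv: "u \<in> coset ` N" "v \<in> coset ` N" for u v
    proof -
      obtain x y where xy: "x \<in> N" "y \<in> N" "u = coset x" "v = coset y" using uv by auto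
      then have "u \<oplus>\<^bsub>Q\<^esub> v = coset (x \<oplus> y)" using N(2) by (simp add: Q_simps(3) subset_iff)
      then show ?thesis using ideal_add[OF N(1) xy(1,2)] by simp
    qed
    show smult: "r \<odot>\<^bsub>Q\<^esub> u \<in> coset ` N" if ru: "r \<in> carrier R" "u \<in> coset ` N" for r u
    proof -
      obtain x where x: "x \<in> N" "u = coset x" using ru(2) by auto
      then have "r \<odot>\<^bsub>Q\<^esub> u = coset (r \<otimes> x)" using N(2) ru(1) by (simp add: Q_simps(4) subset_iff)
      then show ?thesis using ideal.I_l_closed[OF N(1) x(1) ru(1)] by simp
    qed
    show "\<ominus>\<^bsub>Q\<^esub> u \<in> coset ` N" if u: "u \<in> coset ` N" for u
    proof -
      have "u \<in> carrier Q" using u N by (auto simp: Q_simps)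
      then have "\<ominus>\<^bsub>Q\<^esub> u = (\<ominus> \<one>) \<odot>\<^bsub>Q\<^esub> u" by (simp add: Q.smult_l_minus)
      then show ?thesis using smult[OF _ u, of "\<ominus> \<one>"] by simp
    qed
  qed
  have strict: "coset ` N \<subset> coset ` N'"
    if N: "ideal N R" "m2 \<subseteq> N" "N \<subset> N'" "N' \<subseteq> \<mm>" for N N'
  proof -
    obtain y where y: "y \<in> N'" "y \<notin> N" using N(3) by auto
    have "coset y \<notin> coset ` N"
    proof
      assume "coset y \<in> coset ` N"
      then obtain x where x: "x \<in> N" "coset y = coset x" by auto
      have "y = \<zero> \<oplus> y" using y N(4) mc by auto
      then have "y \<in> coset y"
        unfolding coset_def mem_a_r_coset M_simps(3) using ideal_zero[OF m2(1)] by blast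
      then obtain z where "z \<in> m2" "y = z \<oplus> x"
        unfolding x(2) unfolding coset_def mem_a_r_coset M_simps(3) by blast
      then show False using y(2) ideal_add[OF N(1)] x(1) N(2) by auto
    qed
    then show ?thesis using y(1) N(3) by auto
  qed
  have emb: "embedding_dim R \<mm> = module_length R Q"
    unfolding embedding_dim_def Q_def M_def m2_def ideal_power_2[OF m] ..
  have "enat n \<le> module_length R Q" if chain: "ideal_chain R n \<mm> m2" for n
  proof -
    obtain N where N: "\<And>i. i \<le> n \<Longrightarrow> ideal (N i) R \<and> m2 \<subseteq> N i \<and> N i \<subseteq> \<mm>"
      "\<And>i. i < n \<Longrightarrow> N i \<subset> N (Suc i)"
      using ideal_chain_function[OF chain m2(1)] by blast
    have "\<forall>i\<le>n. submodule (coset ` N i) R Q" using sub N(1) by blast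
    moreover have "\<forall>i<n. coset ` N i \<subset> coset ` N (Suc i)"
      using strict N by (meson Suc_leI less_imp_le)
    ultimately show ?thesis
      unfolding module_length_def by (intro Sup_upper) (auto intro!: exI[of _ "\<lambda>i. coset ` N i"])
  qed
  then show ?thesis
    unfolding emb m2_def[symmetric] unfolding ideal_length_def[of R \<mm>] by (auto intro: Sup_least)
qed

section \<open>Vanishing of \<open>Ext\<^sup>1\<close>\<close>

text \<open>The homomorphism \<open>(a) \<rightarrow> R\<close> with \<open>a \<mapsto> c\<close> exists if \<open>c\<close> annihilates \<open>0 :\<^sub>R a\<close>; composed with
  \<open>F1 \<rightarrow> syzygy (R/(a)) \<rightarrow> (a)\<close> it is a cocycle, and it is a coboundary only if \<open>c\<close> is a multiple
  of \<open>a\<close>.\<close>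

lemma (in cring) Ext1_trivial_imp_dual:
  assumes a: "a \<in> carrier R"
    and triv: "carrier (Ext1 R (quotient_module (regular_module R) (PIdl a)) (regular_module R)) =
      {\<zero>\<^bsub>Ext1 R (quotient_module (regular_module R) (PIdl a)) (regular_module R)\<^esub>}"
  shows "annihilator R (annihilator R {a}) \<subseteq> PIdl a"
proof
  fix c assume c: "c \<in> annihilator R (annihilator R {a})"
  then have cc: "c \<in> carrier R" by (simp add: annihilator_def)
  let ?RM = "regular_module R"
  let ?Q = "PIdl a"
  have Q: "ideal ?Q R" using cgenideal_ideal[OF a] .
  interpret RM: module R ?RM by (rule module_regular)
  have subQ: "submodule ?Q R ?RM" by (rule submodule_regular[OF Q])
  define M where "M = quotient_module ?RM ?Q"
  note quot = RM.module_quotient[OF subQ, folded M_def]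
  interpret M: module R M by (rule quot(1))
  define K where "K = syzygy R M"
  interpret K: module R K unfolding K_def by (rule M.module_syzygy)
  define L where "L = syzygy R K"
  interpret L: module R L unfolding L_def by (rule K.module_syzygy)
  let ?F0 = "free_cover R M"
  let ?F1 = "free_cover R K"
  let ?F2 = "free_cover R L"
  let ?d1 = "cover_map R K"
  let ?d2 = "cover_map R L"
  interpret F0: module R ?F0 unfolding free_cover_def by (rule module_free)
  interpret F1: module R ?F1 unfolding free_cover_def by (rule module_free)
  interpret F2: module R ?F2 unfolding free_cover_def by (rule module_free)
  define \<pi> where "\<pi> x = ?Q +>\<^bsub>?RM\<^esub> x" for x
  have M_simps: "carrier M = \<pi> ` carrier R" "\<zero>\<^bsub>M\<^esub> = ?Q"
    "\<And>x y. x \<in> carrier R \<Longrightarrow> y \<in> carrier R \<Longrightarrow> \<pi> x \<oplus>\<^bsub>M\<^esub> \<pi> y = \<pi> (x \<oplus> y)"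
    "\<And>r x. r \<in> carrier R \<Longrightarrow> x \<in> carrier R \<Longrightarrow> r \<odot>\<^bsub>M\<^esub> \<pi> x = \<pi> (r \<otimes> x)"
    using quot(2-5) by (simp_all add: \<pi>_def)
  have mem_\<pi>: "y \<in> \<pi> x \<longleftrightarrow> (\<exists>q\<in>?Q. y = q \<oplus> x)" for x y
    by (simp add: \<pi>_def mem_a_r_coset)
  have \<pi>_self: "x \<in> \<pi> x" if "x \<in> carrier R" for x
    unfolding mem_\<pi> using ideal_zero[OF Q] that by (intro bexI[of _ \<zero>]) auto
  \<comment> \<open>An arbitrary choice of representatives. As the cover is free on the elements of
    \<open>R/(a)\<close>, the choice extends linearly to \<open>lift\<close>, through which the
    cover map factors.\<close>
  define \<sigma> where "\<sigma> s = (SOME x. x \<in> carrier R \<and> \<pi> x = s)" for s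
  have \<sigma>: "\<sigma> s \<in> carrier R" "\<pi> (\<sigma> s) = s" if "s \<in> carrier M" for s
  proof -
    have "\<exists>x. x \<in> carrier R \<and> \<pi> x = s" using that by (auto simp: M_simps(1))
    from someI_ex[OF this] show "\<sigma> s \<in> carrier R" "\<pi> (\<sigma> s) = s" by (auto simp: \<sigma>_def)
  qed
  have \<sigma>_fun: "\<sigma> \<in> carrier M \<rightarrow> carrier ?RM" using \<sigma> by simp
  define lift where "lift = linear_extension R ?RM \<sigma>"
  have lift_closed: "lift f \<in> carrier R" if "f \<in> carrier ?F0" for f
    using RM.linear_extension_closed[OF _ \<sigma>_fun] that by (simp add: lift_def free_cover_def)
  have lift_add: "lift (f \<oplus>\<^bsub>?F0\<^esub> g) = lift f \<oplus> lift g" if "f \<in> carrier ?F0" "g \<in> carrier ?F0" for f g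
    using RM.linear_extension_add[OF _ _ \<sigma>_fun] that by (simp add: lift_def free_cover_def)
  have lift_smult: "lift (r \<odot>\<^bsub>?F0\<^esub> f) = r \<otimes> lift f" if "r \<in> carrier R" "f \<in> carrier ?F0" for r f
    using RM.linear_extension_smult[OF _ _ \<sigma>_fun] that by (simp add: lift_def free_cover_def)
  have lift_zero: "lift \<zero>\<^bsub>?F0\<^esub> = \<zero>"
    using RM.linear_extension_zero by (simp add: lift_def free_cover_def)
  have \<pi>_lift: "\<pi> (lift f) = cover_map R M f" if f: "f \<in> carrier ?F0" for f
  proof -
    have "\<pi> (lift f) = linear_extension R M (\<lambda>s. \<pi> (\<sigma> s)) f"
      unfolding lift_def
      by (rule RM.linear_extension_comp[OF quot(1) _ _ _ _ \<sigma>_fun])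
        (use f in \<open>auto simp: M_simps free_cover_def\<close>)
    also have "\<dots> = linear_extension R M (\<lambda>s. s) f"
      unfolding linear_extension_def using f free_moduleD[of f R "carrier M"] \<sigma>
      by (intro M.M.finsum_cong') (auto simp: free_cover_def subset_iff)
    finally show ?thesis by (simp add: cover_map_eq)
  qed
  \<comment> \<open>The cover map vanishes on syzygies, so \<open>lift\<close> sends them into the
    zero coset, which is \<open>(a)\<close>.\<close>
  have K_F0: "f \<in> carrier ?F0" "lift f \<in> ?Q" if "f \<in> carrier K" for f
  proof -
    have f: "f \<in> carrier ?F0" "cover_map R M f = ?Q"
      using that by (auto simp: K_def M.carrier_syzygy M_simps)
    then show "f \<in> carrier ?F0" "lift f \<in> ?Q"
      using \<pi>_lift[OF f(1)] \<pi>_self[OF lift_closed[OF f(1)]] by auto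
  qed
  \<comment> \<open>Division by \<open>a\<close> on \<open>(a)\<close>. The quotient is determined
    only up to \<open>0 : a\<close>, so \<open>\<tau>\<close> alone need not be additive.\<close>
  define \<tau> where "\<tau> z = (SOME t. t \<in> carrier R \<and> z = t \<otimes> a)" for z
  have \<tau>: "\<tau> z \<in> carrier R" "\<tau> z \<otimes> a = z" if "z \<in> ?Q" for z
  proof -
    have "\<exists>t. t \<in> carrier R \<and> z = t \<otimes> a" using that by (auto simp: cgenideal_def)
    from someI_ex[OF this] show "\<tau> z \<in> carrier R" "\<tau> z \<otimes> a = z" by (auto simp: \<tau>_def)
  qed
  \<comment> \<open>Two quotients differ by an element of \<open>0 : a\<close>, which
    \<open>c\<close> kills. Hence \<open>c \<otimes> \<tau> z\<close> is the well-defined map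
    \<open>(a) \<rightarrow> R\<close> with \<open>a \<mapsto> c\<close>.\<close>
  have c\<tau>: "c \<otimes> \<tau> (t \<otimes> a) = c \<otimes> t" if t: "t \<in> carrier R" for t
  proof -
    have "t \<otimes> a \<in> ?Q" using t by (auto simp: cgenideal_def)
    note \<tau>t = \<tau>[OF this]
    have "(\<tau> (t \<otimes> a) \<ominus> t) \<otimes> a = \<tau> (t \<otimes> a) \<otimes> a \<ominus> t \<otimes> a"
      using \<tau>t(1) t a by (simp add: a_minus_def l_distr l_minus)
    also have "\<dots> = \<zero>" unfolding \<tau>t(2) using t a by (simp add: a_minus_def r_neg)
    finally have "\<tau> (t \<otimes> a) \<ominus> t \<in> annihilator R {a}" using \<tau>t t by (simp add: annihilator_def)
    then have "c \<otimes> (\<tau> (t \<otimes> a) \<ominus> t) = \<zero>" using c by (simp add: annihilator_def)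
    then have "c \<otimes> \<tau> (t \<otimes> a) \<oplus> \<ominus> (c \<otimes> t) = \<zero>"
      using \<tau>t(1) t cc by (simp add: a_minus_def r_distr r_minus)
    then show ?thesis using \<tau>t(1) t cc by (metis m_closed minus_equality minus_minus a_inv_closed)
  qed
  define \<theta> where "\<theta> f = c \<otimes> \<tau> (lift f)" for f
  have \<theta>: "\<exists>t\<in>carrier R. lift f = t \<otimes> a \<and> \<theta> f = c \<otimes> t" if "f \<in> carrier K" for f
    using \<tau>[OF K_F0(2)[OF that]] by (intro bexI[of _ "\<tau> (lift f)"]) (auto simp: \<theta>_def)
  have \<theta>_eq: "\<theta> f = c \<otimes> t" if "lift f = t \<otimes> a" "t \<in> carrier R" for f t
    unfolding \<theta>_def that(1) by (rule c\<tau>[OF that(2)])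
  define \<phi> where "\<phi> = (\<lambda>F\<in>carrier ?F1. \<theta> (?d1 F))"
  have d1K: "?d1 F \<in> carrier K" if "F \<in> carrier ?F1" for F using that by (rule K.cover_map_closed)
  have K_simps: "\<zero>\<^bsub>K\<^esub> = \<zero>\<^bsub>?F0\<^esub>" "\<And>x y. x \<oplus>\<^bsub>K\<^esub> y = x \<oplus>\<^bsub>?F0\<^esub> y" "\<And>r x. r \<odot>\<^bsub>K\<^esub> x = r \<odot>\<^bsub>?F0\<^esub> x"
    by (simp_all add: K_def)
  have \<phi>_hom: "\<phi> \<in> module_hom R ?F1 ?RM"
    unfolding module_hom_def
  proof (intro CollectI conjI ballI)
    show "\<phi> \<in> carrier ?F1 \<rightarrow>\<^sub>E carrier ?RM"
      using \<theta>[OF d1K] cc by (fastforce simp: \<phi>_def)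
    fix F G assume F: "F \<in> carrier ?F1" and G: "G \<in> carrier ?F1"
    obtain t u where t: "t \<in> carrier R" "lift (?d1 F) = t \<otimes> a" "\<theta> (?d1 F) = c \<otimes> t"
      and u: "u \<in> carrier R" "lift (?d1 G) = u \<otimes> a" "\<theta> (?d1 G) = c \<otimes> u"
      using \<theta>[OF d1K[OF F]] \<theta>[OF d1K[OF G]] by blast
    have "lift (?d1 (F \<oplus>\<^bsub>?F1\<^esub> G)) = (t \<oplus> u) \<otimes> a"
      using K.cover_map_add[OF F G] lift_add[OF K_F0(1)[OF d1K[OF F]] K_F0(1)[OF d1K[OF G]]] t u a
      by (simp add: K_simps l_distr)
    then have "\<theta> (?d1 (F \<oplus>\<^bsub>?F1\<^esub> G)) = c \<otimes> (t \<oplus> u)" using t u by (intro \<theta>_eq) auto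
    then show "\<phi> (F \<oplus>\<^bsub>?F1\<^esub> G) = \<phi> F \<oplus>\<^bsub>?RM\<^esub> \<phi> G"
      using F G t u cc by (simp add: \<phi>_def r_distr)
  next
    fix r F assume r: "r \<in> carrier R" and F: "F \<in> carrier ?F1"
    obtain t where t: "t \<in> carrier R" "lift (?d1 F) = t \<otimes> a" "\<theta> (?d1 F) = c \<otimes> t"
      using \<theta>[OF d1K[OF F]] by blast
    have "lift (?d1 (r \<odot>\<^bsub>?F1\<^esub> F)) = (r \<otimes> t) \<otimes> a"
      using K.cover_map_smult[OF r F] lift_smult[OF r K_F0(1)[OF d1K[OF F]]] t r a
      by (simp add: K_simps m_assoc)
    then have "\<theta> (?d1 (r \<odot>\<^bsub>?F1\<^esub> F)) = c \<otimes> (r \<otimes> t)" using t r by (intro \<theta>_eq) auto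
    then show "\<phi> (r \<odot>\<^bsub>?F1\<^esub> F) = r \<odot>\<^bsub>?RM\<^esub> \<phi> F"
      using F t cc r by (simp add: \<phi>_def m_lcomm)
  qed
  let ?H0 = "Hom_module R ?F0 ?RM"
  let ?H1 = "Hom_module R ?F1 ?RM"
  let ?H2 = "Hom_module R ?F2 ?RM"
  define d where "d = (\<lambda>\<psi> :: ('a set \<Rightarrow> 'a) \<Rightarrow> 'a. compose (carrier ?F1) \<psi> ?d1)"
  define e where "e = (\<lambda>\<psi> :: (('a set \<Rightarrow> 'a) \<Rightarrow> 'a) \<Rightarrow> 'a. compose (carrier ?F2) \<psi> ?d2)"
  have Ext: "Ext1 R M ?RM = quotient_module (?H1\<lparr>carrier := a_kernel ?H1 ?H2 e\<rparr>) (d ` carrier ?H0)"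
    unfolding Ext1_def homology_module_def Let_def d_def e_def K_def L_def ..
  \<comment> \<open>The values of \<open>?d2\<close> are syzygies of \<open>K\<close>, so
    \<open>?d1\<close> sends them to zero.\<close>
  have "e \<phi> = \<zero>\<^bsub>?H2\<^esub>"
  proof -
    have "\<phi> (?d2 F) = \<zero>" if "F \<in> carrier ?F2" for F
    proof -
      have "?d2 F \<in> carrier L" using that by (rule L.cover_map_closed)
      then have "?d2 F \<in> carrier ?F1" "?d1 (?d2 F) = \<zero>\<^bsub>?F0\<^esub>"
        by (auto simp: L_def K.carrier_syzygy K_simps)
      moreover have "\<theta> \<zero>\<^bsub>?F0\<^esub> = c \<otimes> \<zero>" using lift_zero a by (intro \<theta>_eq) auto
      ultimately show ?thesis using cc by (simp add: \<phi>_def)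
    qed
    then show ?thesis by (auto simp: e_def Hom_module_def compose_def)
  qed
  then have ker: "\<phi> \<in> a_kernel ?H1 ?H2 e"
    using \<phi>_hom by (simp add: a_kernel_def' Hom_module_def)
  have zero_hom: "(\<lambda>x\<in>carrier ?F0. \<zero>) \<in> carrier ?H0"
    by (auto simp: Hom_module_def module_hom_def)
  let ?E = "?H1\<lparr>carrier := a_kernel ?H1 ?H2 e\<rparr>"
  have "(d ` carrier ?H0) +>\<^bsub>?E\<^esub> \<phi> \<in> carrier (Ext1 R M ?RM)"
    unfolding Ext using ker
    by (auto simp: quotient_module_def A_RCOSETS_def RCOSETS_def a_r_coset_def)
  also have "\<dots> = {d ` carrier ?H0}"
    using triv unfolding M_def[symmetric] unfolding Ext by (simp add: quotient_module_def)
  finally have coset: "(d ` carrier ?H0) +>\<^bsub>?E\<^esub> \<phi> = d ` carrier ?H0" by simp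
  \<comment> \<open>The zero coboundary shows that \<open>\<phi>\<close> lies in its own coset. By
    triviality that coset is the set of coboundaries.\<close>
  have "\<phi> = d (\<lambda>x\<in>carrier ?F0. \<zero>) \<oplus>\<^bsub>?E\<^esub> \<phi>"
  proof
    fix F
    have "\<phi> F \<in> carrier R" if "F \<in> carrier ?F1"
      using \<phi>_hom that by (auto simp: module_hom_def PiE_iff)
    then show "\<phi> F = (d (\<lambda>x\<in>carrier ?F0. \<zero>) \<oplus>\<^bsub>?E\<^esub> \<phi>) F"
      using K_F0(1)[OF d1K, of F] by (auto simp: Hom_module_def d_def compose_def \<phi>_def)
  qed
  then have "\<phi> \<in> (d ` carrier ?H0) +>\<^bsub>?E\<^esub> \<phi>"
    unfolding mem_a_r_coset using zero_hom by blast
  then obtain \<psi> where \<psi>: "\<psi> \<in> carrier ?H0" "\<phi> = d \<psi>" unfolding coset by blast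
  have \<psi>_hom: "\<psi> \<in> module_hom R ?F0 ?RM" using \<psi>(1) by (simp add: Hom_module_def)
  \<comment> \<open>The relation \<open>a * 1 = 0\<close> in \<open>R/(a)\<close> is followed
    through the resolution: \<open>e1\<close> is the basis element over the class \<open>s\<close>
    of 1, \<open>k = a e1\<close> is a syzygy, and \<open>b\<close> is the basis element over
    \<open>k\<close>, so \<open>?d1 b = k\<close>.\<close>
  define s where "s = \<pi> \<one>"
  have s: "s \<in> carrier M" by (simp add: s_def M_simps)
  define e1 where "e1 = (\<lambda>x. if x = s then \<one> else \<zero>)"
  define k where "k = (\<lambda>x. if x = s then a else \<zero>)"
  define b where "b = (\<lambda>f. if f = k then \<one> else \<zero>)"
  have e1: "e1 \<in> carrier ?F0"
    unfolding e1_def free_cover_def by (rule RM.linear_extension_single[OF s _ \<sigma>_fun]) simp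
  have k: "k \<in> carrier ?F0" "lift k = a \<otimes> \<sigma> s"
    unfolding k_def free_cover_def lift_def
    using RM.linear_extension_single[OF s a \<sigma>_fun] by simp_all
  have "cover_map R M k = a \<odot>\<^bsub>M\<^esub> s"
    unfolding k_def cover_map_eq using M.linear_extension_single(2)[OF s a, of "\<lambda>x. x"] by simp
  also have "\<dots> = \<pi> a" using a by (simp add: s_def M_simps)
  also have "\<dots> = ?Q"
    unfolding \<pi>_def using a_rcos_zero[OF Q cgenideal_self[OF a]]
    by (simp add: a_r_coset_def' regular_module_def)
  finally have kK: "k \<in> carrier K"
    using k(1) by (simp add: K_def M.carrier_syzygy M_simps)
  have b: "b \<in> carrier ?F1" "?d1 b = k"
  proof -
    have id: "(\<lambda>x. x) \<in> carrier K \<rightarrow> carrier K" by simp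
    show "b \<in> carrier ?F1"
      unfolding b_def free_cover_def by (rule K.linear_extension_single[OF kK _ id]) simp
    show "?d1 b = k"
      unfolding b_def cover_map_eq using K.linear_extension_single(2)[OF kK one_closed id] kK by simp
  qed
  \<comment> \<open>The representative chosen for the class of 1 need not be 1, but it differs from
    1 by a multiple of \<open>a\<close>.\<close>
  have \<sigma>s: "\<sigma> s \<in> carrier R" "\<pi> (\<sigma> s) = s" using \<sigma>[OF s] by auto
  then have "\<sigma> s \<in> \<pi> \<one>" using \<pi>_self s_def by auto
  then obtain w where w: "w \<in> carrier R" "\<sigma> s = w \<otimes> a \<oplus> \<one>"
    unfolding mem_\<pi> by (auto simp: cgenideal_def)
  \<comment> \<open>Since \<open>lift k = \<sigma> s \<otimes> a\<close>, the quotient to be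
    multiplied by \<open>c\<close> is \<open>\<sigma> s\<close>.\<close>
  have "\<phi> b = \<theta> k" using b by (simp add: \<phi>_def)
  also have "\<dots> = c \<otimes> \<sigma> s" using k \<sigma>s a by (intro \<theta>_eq) (auto simp: m_comm)
  finally have 1: "\<phi> b = c \<otimes> w \<otimes> a \<oplus> c" using w a cc by (simp add: r_distr m_assoc)
  \<comment> \<open>On the coboundary side, linearity of \<open>\<psi>\<close> makes the value at
    \<open>b\<close> a multiple of \<open>a\<close>. Comparing both values leaves \<open>c\<close>
    in \<open>(a)\<close>.\<close>
  have "k = a \<odot>\<^bsub>?F0\<^esub> e1" using a by (auto simp: k_def e1_def free_cover_def free_module_def)
  then have "\<psi> k = a \<otimes> \<psi> e1" using \<psi>_hom e1 a by (simp add: module_hom_def)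
  moreover have "\<phi> b = \<psi> k" using b unfolding \<psi>(2) d_def by (simp add: compose_def)
  moreover have \<psi>e: "\<psi> e1 \<in> carrier R" using \<psi>_hom e1 by (auto simp: module_hom_def)
  ultimately have 2: "\<phi> b = \<psi> e1 \<otimes> a" using a by (simp add: m_comm)
  have "c = (c \<otimes> w \<otimes> a \<oplus> c) \<ominus> c \<otimes> w \<otimes> a"
    using cc w a by (simp add: a_minus_def a_comm[of "c \<otimes> w \<otimes> a"] a_assoc r_neg)
  also have "\<dots> = \<psi> e1 \<otimes> a \<ominus> c \<otimes> w \<otimes> a" using 1 2 by simp
  also have "\<dots> \<in> ?Q"
    by (rule ideal_diff[OF Q]) (use \<psi>e cc w in \<open>auto simp: cgenideal_def\<close>)
  finally show "c \<in> ?Q" .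
qed

theorem theorem1p4:
  fixes R :: "('a, 'b) ring_scheme" and \<mm> :: "'a set"
  assumes "local_ring \<mm> R" and "noetherian_ring R"
    and "krull_dim R = 1"
    and "ideal_prod R (ideal_power R \<mm> 2) (local_cohomology_0 R \<mm>) = {\<zero>\<^bsub>R\<^esub>}"
    and "embedding_dim R \<mm> \<le> 4"
  shows "\<forall>Q. parameter_ideal R \<mm> Q \<longrightarrow>
    carrier (Ext1 R (quotient_module (regular_module R) Q) (regular_module R)) \<noteq>
      {\<zero>\<^bsub>Ext1 R (quotient_module (regular_module R) Q) (regular_module R)\<^esub>}"
proof (intro allI impI notI)
  fix Q
  assume param: "parameter_ideal R \<mm> Q"
    and triv: "carrier (Ext1 R (quotient_module (regular_module R) Q) (regular_module R)) =
      {\<zero>\<^bsub>Ext1 R (quotient_module (regular_module R) Q) (regular_module R)\<^esub>}"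
  interpret local_ring \<mm> R by fact
  obtain a where a: "a \<in> \<mm>" "Q = PIdl\<^bsub>R\<^esub> a" and rad: "radical R (PIdl\<^bsub>R\<^esub> a) = \<mm>"
    using param by (auto simp: parameter_ideal_def)
  have ac: "a \<in> carrier R" using a(1) by simp
  show False
  proof (rule no_dual_parameter[OF assms(2) a(1) rad])
    show "a [^]\<^bsub>R\<^esub> n \<noteq> \<zero>\<^bsub>R\<^esub>" for n :: nat
      by (rule parameter_not_nilpotent[OF assms(3) rad ac])
    show "y \<otimes>\<^bsub>R\<^esub> x = \<zero>\<^bsub>R\<^esub>" if "y \<in> ideal_prod R \<mm> \<mm>" "x \<in> local_cohomology_0 R \<mm>" for y x
      using ideal_prod.prod[OF that, of R] assms(4) by (simp add: ideal_power_2[OF is_ideal])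
    show "ideal_length R \<mm> (ideal_prod R \<mm> \<mm>) \<le> 4"
      using ideal_length_le_embedding_dim[OF is_ideal] assms(5) by (rule order_trans)
    show "annihilator R (annihilator R {a}) \<subseteq> PIdl\<^bsub>R\<^esub> a"
      using Ext1_trivial_imp_dual[OF ac] triv a(2) by simp
  qed
qed

end
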